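(* Let $\epsilon>0$. In the asymmetric streaming model with an offline string $\bar{s}$ and an online string $s$, both of length $n$, there exists a single-pass deterministic streaming algorithm that finds a $(1-\epsilon)$-approximation of $\mathrm{lcs}(\bar{s},s)$ (a value $L$ with $(1-\epsilon)\,\mathrm{lcs}(\bar{s},s)\le L\le \mathrm{lcs}(\bar{s},s)$) using $\tilde{O}(\sqrt{n}/\epsilon)$ memory.
   Context: $\mathrm{lcs}(x,y)$ is the length of a longest common subsequence of $x$ and $y$. In the asymmetric streaming model the algorithm has random (query) access to the offline string $\bar{s}$ while the characters of the online string $s$ arrive as a stream. $\tilde{O}$ hides polylogarithmic factors in $n$. *)

theory Defs
  imports Complex_Main "HOL-Library.Sublist" "HOL-Library.Discrete_Functions"
begin

definition lcs :: "'a list \<Rightarrow> 'a list \<Rightarrow> nat" where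
  "lcs x y = Max (length ` {z. subseq z x \<and> subseq z y})"

text \<open>
  Asymmetric streaming machines. An algorithm is a deterministic program in a small imperative
  language with a contiguous, indirectly addressed working memory. It has query access to the
  offline string through \<^verbatim>\<open>Off\<close>, and its only access to the online string is \<^verbatim>\<open>Next\<close>, which
  consumes one character of the stream; hence a run makes a single pass. The length of the strings
  and a precision parameter are read-only inputs. The alphabet is an arbitrary type: a program can
  copy characters and test them for equality, nothing else.
\<close>

datatype 'a val = Num nat | Chr 'a

datatype expr =
    Const nat
  | Len
  | Prec
  | Mem expr
  | Off expr
  | Add expr expr
  | Sub expr expr
  | Mul expr expr
  | Div expr expr
  | Mod expr expr
  | Less expr expr
  | Eq expr expr

datatype cmd =
    Skip
  | Store expr expr
  | Next expr
  | Seq cmd cmd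
  | Cond expr cmd cmd
  | While expr cmd

fun num :: "'a val \<Rightarrow> nat" where
  "num (Num v) = v"
| "num (Chr c) = 0"

definition cell :: "'a val list \<Rightarrow> nat \<Rightarrow> 'a val" where
  "cell m i = (if i < length m then m ! i else Num 0)"

text \<open>
  Writing beyond the end allocates all cells below the address as well, so that no information can
  be hidden in the set of allocated addresses.
\<close>

definition store :: "'a val list \<Rightarrow> nat \<Rightarrow> 'a val \<Rightarrow> 'a val list" where
  "store m i v =
     (if i < length m then m[i := v] else m @ replicate (i - length m) (Num 0) @ [v])"

text \<open>
  An integer is charged its binary length, so packing data into large integers does not
  save memory. A character is charged one unit, because the alphabet is arbitrary; for an alphabet
  of size polynomial in the length of the strings this is its bit length up to a logarithmic factor.
\<close>

fun val_size :: "'a val \<Rightarrow> nat" where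
  "val_size (Num v) = floor_log v + 1"
| "val_size (Chr c) = 1"

definition mem_size :: "'a val list \<Rightarrow> nat" where
  "mem_size m = sum_list (map val_size m)"

fun eval :: "'a list \<Rightarrow> nat \<Rightarrow> 'a val list \<Rightarrow> expr \<Rightarrow> 'a val" where
  "eval xs k m (Const v) = Num v"
| "eval xs k m Len = Num (length xs)"
| "eval xs k m Prec = Num k"
| "eval xs k m (Mem e) = cell m (num (eval xs k m e))"
| "eval xs k m (Off e) =
     (let i = num (eval xs k m e) in if i < length xs then Chr (xs ! i) else Num 0)"
| "eval xs k m (Add e f) = Num (num (eval xs k m e) + num (eval xs k m f))"
| "eval xs k m (Sub e f) = Num (num (eval xs k m e) - num (eval xs k m f))"
| "eval xs k m (Mul e f) = Num (num (eval xs k m e) * num (eval xs k m f))"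
| "eval xs k m (Div e f) = Num (num (eval xs k m e) div num (eval xs k m f))"
| "eval xs k m (Mod e f) = Num (num (eval xs k m e) mod num (eval xs k m f))"
| "eval xs k m (Less e f) = Num (of_bool (num (eval xs k m e) < num (eval xs k m f)))"
| "eval xs k m (Eq e f) = Num (of_bool (eval xs k m e = eval xs k m f))"

text \<open>
  \<^verbatim>\<open>exec xs k B c (m, ys) (m', ys')\<close>: with offline string \<^verbatim>\<open>xs\<close> and precision parameter \<^verbatim>\<open>k\<close>, the
  command \<^verbatim>\<open>c\<close>, started with memory \<^verbatim>\<open>m\<close> and remaining stream \<^verbatim>\<open>ys\<close>, terminates with memory \<^verbatim>\<open>m'\<close>
  and remaining stream \<^verbatim>\<open>ys'\<close>, and no memory written during the run has size greater than \<^verbatim>\<open>B\<close>.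
\<close>

inductive exec ::
    "'a list \<Rightarrow> nat \<Rightarrow> nat \<Rightarrow> cmd \<Rightarrow> 'a val list \<times> 'a list \<Rightarrow> 'a val list \<times> 'a list \<Rightarrow> bool"
  for xs :: "'a list" and k B :: nat
where
  Skip: "exec xs k B Skip st st"
| Store: "m' = store m (num (eval xs k m a)) (eval xs k m e) \<Longrightarrow> mem_size m' \<le> B \<Longrightarrow>
    exec xs k B (Store a e) (m, ys) (m', ys)"
| Next: "m' = store m (num (eval xs k m a)) (Chr y) \<Longrightarrow> mem_size m' \<le> B \<Longrightarrow>
    exec xs k B (Next a) (m, y # ys) (m', ys)"
| Seq: "exec xs k B c st st' \<Longrightarrow> exec xs k B d st' st'' \<Longrightarrow> exec xs k B (Seq c d) st st''"
| CondTrue: "num (eval xs k (fst st) e) \<noteq> 0 \<Longrightarrow> exec xs k B c st st' \<Longrightarrow>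
    exec xs k B (Cond e c d) st st'"
| CondFalse: "num (eval xs k (fst st) e) = 0 \<Longrightarrow> exec xs k B d st st' \<Longrightarrow>
    exec xs k B (Cond e c d) st st'"
| WhileFalse: "num (eval xs k (fst st) e) = 0 \<Longrightarrow> exec xs k B (While e c) st st"
| WhileTrue: "num (eval xs k (fst st) e) \<noteq> 0 \<Longrightarrow> exec xs k B c st st' \<Longrightarrow>
    exec xs k B (While e c) st' st'' \<Longrightarrow> exec xs k B (While e c) st st''"

inductive_cases exec_SkipE: "exec xs k B Skip st st'"
inductive_cases exec_StoreE: "exec xs k B (Store a e) st st'"
inductive_cases exec_NextE: "exec xs k B (Next a) st st'"
inductive_cases exec_SeqE: "exec xs k B (Seq c d) st st'"
inductive_cases exec_CondE: "exec xs k B (Cond e c d) st st'"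
inductive_cases exec_WhileE: "exec xs k B (While e c) st st'"

lemma exec_deterministic:
  "exec xs k B c st st' \<Longrightarrow> exec xs k B' c st st'' \<Longrightarrow> st'' = st'"
proof (induction arbitrary: st'' rule: exec.induct)
  case (Skip st)
  then show ?case by (auto elim: exec_SkipE)
next
  case (Store m' m a e ys)
  from Store.prems show ?case by (rule exec_StoreE) (use Store.hyps in auto)
next
  case (Next m' m a y ys)
  from Next.prems show ?case by (rule exec_NextE) (use Next.hyps in auto)
next
  case (Seq c st st' d st2)
  from Seq.prems show ?case by (rule exec_SeqE) (use Seq.IH in blast)
next
  case (CondTrue st e c st' d)
  from CondTrue.prems show ?case by (rule exec_CondE) (use CondTrue in auto)
next
  case (CondFalse st e d st' c)
  from CondFalse.prems show ?case by (rule exec_CondE) (use CondFalse in auto)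
next
  case (WhileFalse st e c)
  from WhileFalse.prems show ?case by (rule exec_WhileE) (use WhileFalse in auto)
next
  case (WhileTrue st e c st' st2)
  from WhileTrue.prems show ?case by (rule exec_WhileE) (use WhileTrue in auto)
qed

text \<open>
  The run starts with empty memory; the output is the integer in cell 0 (which is 0 if that cell
  was never written).
\<close>

definition stream_output :: "cmd \<Rightarrow> nat \<Rightarrow> 'a list \<Rightarrow> 'a list \<Rightarrow> nat \<Rightarrow> nat \<Rightarrow> bool" where
  "stream_output P k xs ys B L \<longleftrightarrow>
     (\<exists>m zs. exec xs k B P ([], ys) (m, zs) \<and> cell m 0 = Num L)"

end

theory Submission
  imports Defs
begin

text \<open>
  Cut the online string into about \<^verbatim>\<open>\<surd>n\<close> blocks of length \<^verbatim>\<open>\<surd>n\<close> and keep, for each value \<^verbatim>\<open>l\<close> in a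
  geometric grid with ratio \<^verbatim>\<open>1 + 1/M\<close>, \<^verbatim>\<open>M = k \<surd>n\<close>, a short prefix of the offline string whose lcs with
  the part of the stream read so far is at least \<^verbatim>\<open>l\<close>. The grid has \<^verbatim>\<open>O(M log n)\<close> values up to \<^verbatim>\<open>n\<close>.
  To process a block, it is stored, and for each grid value the usual lcs dynamic program is run
  between the block and the offline string, started at the prefix kept for that value; every lcs
  value found is rounded down to the grid. A block thus costs a factor \<^verbatim>\<open>M/(M + 1)\<close>, and by Bernoulli's
  inequality all blocks together cost at most a factor \<^verbatim>\<open>1 - 1/k \<ge> 1 - \<epsilon>\<close>. The table can be
  updated in place if grid values are treated in decreasing order, because a value only influences
  larger ones. For \<^verbatim>\<open>\<epsilon> \<ge> 1\<close> (that is, \<^verbatim>\<open>k = 1\<close>) and for \<^verbatim>\<open>n = 0\<close> the memory bound can be less than one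
  cell, so there the program must answer 0 without writing anything.
\<close>

section \<open>Reachable positions\<close>

definition reach :: "'a list \<Rightarrow> 'a list \<Rightarrow> nat \<Rightarrow> nat \<Rightarrow> bool" where
  "reach xs ys p l \<longleftrightarrow> (\<exists>z. subseq z (take p xs) \<and> subseq z ys \<and> length z = l)"

lemma finite_common_subseq: "finite {z. subseq z x \<and> subseq z y}"
  by (rule finite_subset[of _ "set (subseqs x)"]) auto

text \<open>A prefix of a common subsequence is again one, so every length up to the maximum is
  attained. In particular \<open>reach\<close> is downward closed in \<open>l\<close>.\<close>

lemma reach_iff_le_lcs: "reach xs ys p l \<longleftrightarrow> l \<le> lcs (take p xs) ys"
proof
  assume "reach xs ys p l"
  then show "l \<le> lcs (take p xs) ys"
    unfolding reach_def lcs_def using finite_common_subseq by (fastforce intro!: Max_ge)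
next
  assume le: "l \<le> lcs (take p xs) ys"
  have "lcs (take p xs) ys \<in> length ` {z. subseq z (take p xs) \<and> subseq z ys}"
    unfolding lcs_def using finite_common_subseq by (intro Max_in) auto
  then obtain z where z: "subseq z (take p xs)" "subseq z ys" "length z = lcs (take p xs) ys"
    by auto
  have "subseq (take l z) z"
    by (metis append_take_drop_id subseq_order.refl list_emb_prefix)
  then show "reach xs ys p l"
    unfolding reach_def using z le by (intro exI[of _ "take l z"]) (auto intro: subseq_order.trans)
qed

lemma reach_0: "reach xs ys p 0"
  by (auto simp: reach_def)

lemma reach_mono:
  assumes "reach xs ys p l" "p \<le> p'"
  shows "reach xs (ys @ zs) p' l"
proof -
  have "subseq (take p xs) (take p' xs)"
    using list_emb_prefix[OF subseq_order.refl[of "take p xs"], of "take (p' - p) (drop p xs)"]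
      take_add[of p "p' - p" xs] assms(2) by simp
  then show ?thesis
    using assms(1) unfolding reach_def
    by (blast intro: subseq_order.trans list_emb_prefix)
qed

lemma reach_Suc:
  assumes "reach xs ys q l" "q < length xs" "xs ! q = c"
  shows "reach xs (ys @ [c]) (Suc q) (Suc l)"
proof -
  obtain z where z: "subseq z (take q xs)" "subseq z ys" "length z = l"
    using assms(1) by (auto simp: reach_def)
  have "take (Suc q) xs = take q xs @ [c]"
    using assms by (simp add: take_Suc_conv_app_nth)
  then show ?thesis
    unfolding reach_def using z
    by (intro exI[of _ "z @ [c]"]) (auto intro: list_emb_append_mono)
qed

text \<open>The case split of the lcs recursion on the last stream character: either the witness
  does without \<open>c\<close>, or its last character is this \<open>c\<close> and \<open>q\<close>
  is the offline position matched to it.\<close>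

lemma reach_snocE:
  assumes "reach xs (ys @ [c]) p l"
  obtains "reach xs ys p l"
  | q l' where "q < p" "q < length xs" "xs ! q = c" "reach xs ys q l'" "l = Suc l'"
proof -
  obtain z where z: "subseq z (take p xs)" "subseq z (ys @ [c])" "length z = l"
    using assms by (auto simp: reach_def)
  obtain z1 z2 where z12: "z = z1 @ z2" "subseq z1 ys" "subseq z2 [c]"
    using z(2) by (auto simp: subseq_append_iff)
  show ?thesis
  proof (cases "z2 = []")
    case True
    then show ?thesis
      using z z12 that(1) by (auto simp: reach_def)
  next
    case False
    then have z2: "z2 = [c]"
      using z12(3) by (cases z2) (auto split: if_splits)
    obtain us v where us: "take p xs = us @ v" "subseq z1 us" "subseq [c] v"
      using z(1) unfolding z12(1) z2 by (blast dest: list_emb_appendD)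
    obtain vs ws where v: "v = vs @ c # ws"
      using us(3) by (metis split_list subseq_singleton_left)
    let ?q = "length (us @ vs)"
    have eq: "take p xs = (us @ vs) @ c # ws"
      using us(1) v by simp
    then have len: "?q < length (take p xs)"
      by simp
    then have q: "?q < p" "?q < length xs"
      by auto
    have "xs ! ?q = c"
      using eq q by (metis nth_append_length nth_take)
    moreover have "take ?q xs = us @ vs"
      using eq q by (metis append_eq_conv_conj min.absorb1 order_less_imp_le take_take)
    then have "reach xs ys ?q (length z1)"
      unfolding reach_def using us(2) z12(2) by (auto intro: list_emb_prefix)
    ultimately show ?thesis
      using that(2) q z(3) z12(1) z2 by auto
  qed
qed

lemma reach_le_length: "reach xs ys p l \<Longrightarrow> l \<le> length xs"
  by (auto simp: reach_def dest!: list_emb_length)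

section \<open>Geometric levels\<close>

text \<open>Integer form of the ratio \<open>1 + 1/M\<close>. The summand 1 keeps the grid strictly
  increasing below \<open>M\<close>, where the quotient is 0, so small values are represented
  exactly.\<close>

primrec lev :: "nat \<Rightarrow> nat \<Rightarrow> nat" where
  "lev M 0 = 0"
| "lev M (Suc j) = lev M j + 1 + lev M j div M"

lemma strict_mono_lev: "strict_mono (lev M)"
  by (simp add: strict_mono_Suc_iff)

lemma lev_ge: "j \<le> lev M j"
  by (induction j) auto

text \<open>Gaps between consecutive levels never shrink, so each of the \<open>i\<close> steps is
  at least as long as the one at \<open>j\<close>.\<close>

lemma lev_add_ge: "lev M (j + i) \<ge> lev M j + i * (1 + lev M j div M)"
proof (induction i)
  case (Suc i)
  have "lev M j div M \<le> lev M (j + i) div M"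
    by (intro div_le_mono strict_mono_leD[OF strict_mono_lev]) simp
  with Suc show ?case by simp
qed simp

text \<open>From a level \<open>l\<close>, \<open>M\<close> steps add at least
  \<open>M * (1 + l div M) >= l\<close> and hence double it. This is why about
  \<open>M log n\<close> levels reach \<open>n\<close>.\<close>

lemma lev_ge_power: "M > 0 \<Longrightarrow> lev M (1 + M * a) \<ge> 2 ^ a"
proof (induction a)
  case (Suc a)
  let ?l = "lev M (1 + M * a)"
  have "?l \<le> M * (1 + ?l div M)"
    using dividend_less_times_div[OF Suc.prems, of ?l] by simp
  then have "2 * ?l \<le> lev M ((1 + M * a) + M)"
    using lev_add_ge[of M "1 + M * a" M] by linarith
  then show ?case
    using Suc by (simp add: algebra_simps)
qed simp

lemma ex_lev_round:
  assumes "M > 0"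
  obtains j where "lev M j \<le> x" "real M / real (M + 1) * real x \<le> real (lev M j)"
proof -
  define j where "j = Greatest (\<lambda>j. lev M j \<le> x)"
  have b: "\<forall>j. lev M j \<le> x \<longrightarrow> j \<le> x"
    using lev_ge le_trans by blast
  have j: "lev M j \<le> x"
    unfolding j_def by (rule GreatestI_nat[of _ 0 x]) (use b in auto)
  \<comment> \<open>By maximality of \<open>j\<close> the next level lies above \<open>x\<close>, so
    \<open>x\<close> exceeds \<open>lev M j\<close> by at most the quotient
    \<open>lev M j div M\<close>.\<close>
  have "\<not> lev M (Suc j) \<le> x"
    unfolding j_def using Greatest_le_nat[of "\<lambda>j. lev M j \<le> x" _ x] b
    by (metis Suc_n_not_le_n)
  then have "x \<le> lev M j + lev M j div M"
    by simp
  then have "M * x \<le> M * lev M j + M * (lev M j div M)"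
    by (metis add_mult_distrib2 mult_le_mono2)
  also have "\<dots> \<le> (M + 1) * lev M j"
    by simp
  finally have "real M * real x \<le> real (M + 1) * real (lev M j)"
    by (metis of_nat_le_iff of_nat_mult)
  then have "real M / real (M + 1) * real x \<le> real (lev M j)"
    by (simp add: field_simps)
  with j that show ?thesis by blast
qed

section \<open>Processing one block\<close>

text \<open>The lcs matrix of the block against the offline string from position \<open>t\<close>
  on, with \<open>p\<close> an absolute offline position. The match test is a factor
  \<open>of_bool\<close> so that the recursion agrees literally with
  \<open>row_expr\<close>.\<close>

fun row :: "'a list \<Rightarrow> 'a list \<Rightarrow> nat \<Rightarrow> nat \<Rightarrow> nat \<Rightarrow> nat" where
  "row xs bs t 0 i = 0"
| "row xs bs t (Suc p) 0 = 0"
| "row xs bs t (Suc p) (Suc i) =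
    (if Suc p \<le> t then 0
     else max (max (row xs bs t p (Suc i)) (row xs bs t (Suc p) i))
            (of_bool (bs ! i = xs ! p) * (row xs bs t p i + 1)))"

lemma row_0 [simp]: "row xs bs t p 0 = 0"
  by (cases p) auto

lemma row_start [simp]: "p \<le> t \<Longrightarrow> row xs bs t p i = 0"
  by (induction xs bs t p i rule: row.induct) auto

lemma row_le: "row xs bs t p i \<le> i"
  by (induction xs bs t p i rule: row.induct) (auto split: if_splits)

lemma row_le_Suc_right: "row xs bs t p i \<le> row xs bs t p (Suc i)"
  by (cases p) auto

lemma row_mono_left: "p \<le> p' \<Longrightarrow> row xs bs t p i \<le> row xs bs t p' i"
proof (induction rule: dec_induct)
  case (step p')
  have "row xs bs t p' i \<le> row xs bs t (Suc p') i"
    by (cases i; cases "Suc p' \<le> t") auto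
  with step show ?case by simp
qed simp

text \<open>The row counts only matches at offline positions from \<open>t\<close> on, so its value
  adds to \<open>l\<close>. Of the three candidates in the maximum, the first two extend a witness
  by \<open>reach_mono\<close>, the match by \<open>reach_Suc\<close>.\<close>

lemma reach_row:
  "reach xs ys t l \<Longrightarrow> t \<le> p \<Longrightarrow> p \<le> length xs \<Longrightarrow> i \<le> length bs \<Longrightarrow>
    reach xs (ys @ take i bs) p (l + row xs bs t p i)"
proof (induction xs bs t p i rule: row.induct)
  case (3 xs bs t p i)
  show ?case
  proof (cases "Suc p \<le> t")
    case True
    then show ?thesis using "3.prems" by (simp add: reach_mono)
  next
    case False
    let ?r = "row xs bs t (Suc p) (Suc i)"
    have snoc: "ys @ take (Suc i) bs = (ys @ take i bs) @ [bs ! i]"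
      using 3 by (simp add: take_Suc_conv_app_nth)
    have "?r = row xs bs t p (Suc i) \<or> ?r = row xs bs t (Suc p) i \<or>
        bs ! i = xs ! p \<and> ?r = Suc (row xs bs t p i)"
      using False by (cases "bs ! i = xs ! p") (simp_all add: max_def)
    then consider "?r = row xs bs t p (Suc i)" | "?r = row xs bs t (Suc p) i"
      | "bs ! i = xs ! p" "?r = Suc (row xs bs t p i)"
      by blast
    then show ?thesis
    proof cases
      case 1
      have "reach xs (ys @ take (Suc i) bs) p (l + row xs bs t p (Suc i))"
        using 3 False by simp
      then show ?thesis
        unfolding 1 using reach_mono[of xs _ p _ "Suc p" "[]"] by simp
    next
      case 2
      have "reach xs (ys @ take i bs) (Suc p) (l + row xs bs t (Suc p) i)"
        using 3 False by simp
      then show ?thesis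
        unfolding 2 snoc by (rule reach_mono) simp
    next
      case c: 3
      have "reach xs (ys @ take i bs) p (l + row xs bs t p i)"
        using 3 False by simp
      then have "reach xs ((ys @ take i bs) @ [bs ! i]) (Suc p) (Suc (l + row xs bs t p i))"
        using 3 c by (intro reach_Suc) auto
      then show ?thesis
        unfolding c(2) snoc by simp
    qed
  qed
qed (auto intro: reach_mono reach_mono[where zs = "[]", simplified])

text \<open>An entry \<^verbatim>\<open>T j > length xs\<close> means that no prefix is known for level \<^verbatim>\<open>j\<close>.\<close>

definition sound_table :: "'a list \<Rightarrow> nat \<Rightarrow> nat \<Rightarrow> 'a list \<Rightarrow> (nat \<Rightarrow> nat) \<Rightarrow> bool" where
  "sound_table xs M J ys T \<longleftrightarrow> (\<forall>j\<le>J. T j \<le> length xs \<longrightarrow> reach xs ys (T j) (lev M j))"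

text \<open>All prefixes \<open>p\<close> are covered, not only the whole offline string, because
  later blocks may continue an optimal subsequence from any position.\<close>

definition complete_table ::
    "real \<Rightarrow> 'a list \<Rightarrow> nat \<Rightarrow> nat \<Rightarrow> 'a list \<Rightarrow> (nat \<Rightarrow> nat) \<Rightarrow> bool" where
  "complete_table \<alpha> xs M J ys T \<longleftrightarrow>
     (\<forall>p\<le>length xs. \<forall>l. reach xs ys p l \<longrightarrow> (\<exists>j\<le>J. T j \<le> p \<and> \<alpha> * real l \<le> real (lev M j)))"

text \<open>No loss occurs inside a block: the level \<open>j\<close> supplied before the block
  serves throughout, while the row grows by at least one with every match of the
  subsequence.\<close>

lemma complete_table_row:
  assumes c: "complete_table \<alpha> xs M J ys T" and \<alpha>: "\<alpha> \<le> 1"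
  shows "i \<le> length bs \<Longrightarrow> p \<le> length xs \<Longrightarrow> reach xs (ys @ take i bs) p l \<Longrightarrow>
    \<exists>j\<le>J. T j \<le> p \<and> \<alpha> * real l \<le> real (lev M j + row xs bs (T j) p i)"
proof (induction i arbitrary: p l)
  case 0
  then show ?case using c by (fastforce simp: complete_table_def)
next
  case (Suc i)
  have "ys @ take (Suc i) bs = (ys @ take i bs) @ [bs ! i]"
    using Suc.prems by (simp add: take_Suc_conv_app_nth)
  with Suc.prems(3) have "reach xs ((ys @ take i bs) @ [bs ! i]) p l"
    by simp
  then show ?case
  proof (cases rule: reach_snocE)
    case 1
    then obtain j where "j \<le> J" "T j \<le> p" "\<alpha> * real l \<le> real (lev M j + row xs bs (T j) p i)"
      using Suc by auto
    moreover have "row xs bs (T j) p i \<le> row xs bs (T j) p (Suc i)"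
      by (rule row_le_Suc_right)
    ultimately show ?thesis by (intro exI[of _ j]) auto
  next
    case (2 q l')
    then obtain j where j: "j \<le> J" "T j \<le> q" "\<alpha> * real l' \<le> real (lev M j + row xs bs (T j) q i)"
      using Suc.IH[of q l'] Suc.prems by auto
    have "Suc (row xs bs (T j) q i) \<le> row xs bs (T j) (Suc q) (Suc i)"
      using 2 j by simp
    also have "\<dots> \<le> row xs bs (T j) p (Suc i)"
      using 2 by (intro row_mono_left) simp
    finally have r: "1 + real (row xs bs (T j) q i) \<le> real (row xs bs (T j) p (Suc i))"
      by linarith
    \<comment> \<open>The new match adds only \<alpha> \<le> 1 on the left but a full 1 to the
      row.\<close>
    have "\<alpha> * real l = \<alpha> * real l' + \<alpha>"
      using 2 by (simp add: algebra_simps)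
    then show ?thesis
      using j r \<alpha> 2 by (intro exI[of _ j]) auto
  qed
qed

text \<open>The premise on \<open>T'\<close> is what the update of the table will guarantee. The
  only loss is that of rounding the exact value down to the grid.\<close>

lemma complete_table_block:
  assumes c: "complete_table \<alpha> xs M J ys T" and s: "sound_table xs M J ys T"
    and \<alpha>: "\<alpha> \<le> 1" and M: "M > 0" and J: "length xs \<le> lev M J"
    and T': "\<And>j p j'. j \<le> j' \<Longrightarrow> j' \<le> J \<Longrightarrow> T j \<le> p \<Longrightarrow> p \<le> length xs \<Longrightarrow>
      lev M j' \<le> lev M j + row xs bs (T j) p (length bs) \<Longrightarrow> T' j' \<le> p"
  shows "complete_table (\<alpha> * (real M / real (M + 1))) xs M J (ys @ bs) T'"
  unfolding complete_table_def
proof (intro allI impI)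
  fix p l assume p: "p \<le> length xs" and r: "reach xs (ys @ bs) p l"
  obtain j where j: "j \<le> J" "T j \<le> p"
      "\<alpha> * real l \<le> real (lev M j + row xs bs (T j) p (length bs))"
    using complete_table_row[OF c \<alpha>, of "length bs" bs p l] p r by auto
  let ?x = "lev M j + row xs bs (T j) p (length bs)"
  obtain j' where j': "lev M j' \<le> ?x" "real M / real (M + 1) * real ?x \<le> real (lev M j')"
    using ex_lev_round[OF M] by blast
  \<comment> \<open>The premise on \<open>T'\<close> concerns only levels from \<open>j\<close>
    upwards. Level \<open>j\<close> does not exceed the value either, so the maximum is admissible
    and no worse than \<open>j'\<close>.\<close>
  let ?j = "max j j'"
  \<comment> \<open>Soundness bounds the value by \<open>length xs\<close>, which keeps the rounded
    level inside the table.\<close>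
  have "reach xs ys (T j) (lev M j)"
    using s j p by (auto simp: sound_table_def)
  from reach_row[OF this j(2) p, of "length bs" bs] have "?x \<le> length xs"
    by (auto dest: reach_le_length)
  then have "lev M j' \<le> lev M J"
    using j' J by linarith
  then have "j' \<le> J"
    by (simp add: strict_mono_less_eq[OF strict_mono_lev])
  then have "?j \<le> J" using j by simp
  have le: "lev M ?j \<le> ?x"
    using j'(1) by (simp add: max_def)
  have "real (lev M j') \<le> real (lev M ?j)"
    by (simp add: strict_mono_less_eq[OF strict_mono_lev])
  moreover have "real M / real (M + 1) * (\<alpha> * real l) \<le> real M / real (M + 1) * real ?x"
    using j(3) by (intro mult_left_mono) auto
  ultimately have "\<alpha> * (real M / real (M + 1)) * real l \<le> real (lev M ?j)"
    using j'(2) by (simp only: mult_ac)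
  moreover have "T' ?j \<le> p"
    using T'[of j ?j p] \<open>?j \<le> J\<close> j p le by simp
  ultimately show "\<exists>j\<le>J. T' j \<le> p \<and> \<alpha> * (real M / real (M + 1)) * real l \<le> real (lev M j)"
    using \<open>?j \<le> J\<close> by blast
qed


section \<open>Interleaved arrays and weakest preconditions\<close>

text \<open>
  The memory is viewed as 16 interleaved arrays, so that they can all grow without knowing their
  final sizes; a variable is entry 0 of an array of its own.
\<close>

definition arr :: "'a val list \<Rightarrow> nat \<Rightarrow> nat \<Rightarrow> 'a val" where
  "arr m c i = cell m (16 * i + c)"

definition upd :: "'a val list \<Rightarrow> nat \<Rightarrow> nat \<Rightarrow> 'a val \<Rightarrow> 'a val list" where
  "upd m c i v = store m (16 * i + c) v"

abbreviation narr :: "'a val list \<Rightarrow> nat \<Rightarrow> nat \<Rightarrow> nat" where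
  "narr m c i \<equiv> num (arr m c i)"

definition var :: "nat \<Rightarrow> expr" where
  "var c = Mem (Const c)"

definition ix :: "nat \<Rightarrow> expr \<Rightarrow> expr" where
  "ix c e = Mem (Add (Mul (Const 16) e) (Const c))"

definition set_var :: "nat \<Rightarrow> expr \<Rightarrow> cmd" where
  "set_var c e = Store (Const c) e"

definition set_ix :: "nat \<Rightarrow> expr \<Rightarrow> expr \<Rightarrow> cmd" where
  "set_ix c a e = Store (Add (Mul (Const 16) a) (Const c)) e"

definition next_ix :: "nat \<Rightarrow> expr \<Rightarrow> cmd" where
  "next_ix c a = Next (Add (Mul (Const 16) a) (Const c))"

text \<open>Padding cells hold \<open>Num 0\<close>, which is also what an unallocated cell reads
  as, so growth of the memory is invisible to \<open>cell\<close>.\<close>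

lemma cell_store: "cell (store m i v) j = (if j = i then v else cell m j)"
  by (auto simp: cell_def store_def nth_append nth_Cons' )

lemma length_store: "length (store m i v) = max (length m) (Suc i)"
  by (simp add: store_def)

lemma set_store: "set (store m i v) \<subseteq> insert v (insert (Num 0) (set m))"
  using set_update_subset_insert[of m i v] by (auto simp: store_def)

lemma arr_upd [simp]:
  assumes "c < 16" "d < 16"
  shows "arr (upd m c i v) d j = (if d = c \<and> j = i then v else arr m d j)"
proof -
  have "16 * j + d = 16 * i + c \<longleftrightarrow> d = c \<and> j = i"
    using assms by (metis add.commute add_left_cancel mod_less mod_mult_self2 mult_cancel1 zero_neq_numeral)
  then show ?thesis by (simp add: arr_def upd_def cell_store)
qed

lemma arr_Nil [simp]: "arr [] c i = Num 0"
  by (simp add: arr_def cell_def)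

lemma eval_var [simp]: "eval xs k m (var c) = arr m c 0"
  by (simp add: var_def arr_def)

lemma eval_ix [simp]: "eval xs k m (ix c e) = arr m c (num (eval xs k m e))"
  by (simp add: ix_def arr_def)

text \<open>A frame condition on whole arrays, by which invariants about all arrays outside
  \<open>C\<close> survive a subprogram.\<close>

definition unchanged :: "nat set \<Rightarrow> 'a val list \<Rightarrow> 'a val list \<Rightarrow> bool" where
  "unchanged C m m' \<longleftrightarrow> (\<forall>c<16. c \<notin> C \<longrightarrow> (\<forall>i. arr m' c i = arr m c i))"

lemma unchangedD: "unchanged C m m' \<Longrightarrow> c < 16 \<Longrightarrow> c \<notin> C \<Longrightarrow> arr m' c i = arr m c i"
  by (simp add: unchanged_def)

lemma unchanged_refl [simp]: "unchanged C m m"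
  by (simp add: unchanged_def)

lemma unchanged_trans:
  "unchanged C m m' \<Longrightarrow> unchanged D m' m'' \<Longrightarrow> C \<subseteq> E \<Longrightarrow> D \<subseteq> E \<Longrightarrow> unchanged E m m''"
  unfolding unchanged_def by (metis subsetD)

lemma unchanged_upd [simp]: "c < 16 \<Longrightarrow> c \<in> C \<Longrightarrow> unchanged C m (upd m' c i v) = unchanged C m m'"
  by (auto simp: unchanged_def)

text \<open>\<^verbatim>\<open>N\<close> bounds the array indices and \<^verbatim>\<open>V\<close> the integers that a run may store.\<close>

locale machine =
  fixes xs :: "'a list" and k N V :: nat
begin

section \<open>Memory size from bounds on indices and values, and total correctness\<close>

definition fits :: "'a val list \<Rightarrow> bool" where
  "fits m \<longleftrightarrow> length m \<le> 16 * N \<and> (\<forall>v\<in>set m. num v \<le> V)"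

definition budget :: nat where
  "budget = 16 * N * (floor_log V + 1)"

lemma fits_mem_size:
  assumes "fits m"
  shows "mem_size m \<le> budget"
proof -
  have "val_size v \<le> floor_log V + 1" if "v \<in> set m" for v
  proof -
    have "val_size v \<le> floor_log (num v) + 1"
      by (cases v) auto
    moreover have "floor_log (num v) \<le> floor_log V"
      using that assms by (intro floor_log_le_iff) (auto simp: fits_def)
    ultimately show ?thesis by simp
  qed
  then have "mem_size m \<le> length m * (floor_log V + 1)"
    unfolding mem_size_def
  proof (induction m)
    case (Cons a m)
    then have "val_size a \<le> floor_log V + 1" "sum_list (map val_size m) \<le> length m * (floor_log V + 1)"
      by auto
    then show ?case by simp
  qed simp
  also have "\<dots> \<le> 16 * N * (floor_log V + 1)"
    using assms by (intro mult_right_mono) (auto simp: fits_def)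
  finally show ?thesis by (simp add: budget_def)
qed

lemma fits_narr: "fits m \<Longrightarrow> narr m c i \<le> V"
  by (auto simp: fits_def arr_def cell_def)

lemma fits_upd:
  assumes "fits m" "num v \<le> V" "c < 16" "i < N"
  shows "fits (upd m c i v)"
proof -
  have "16 * i + c < 16 * N"
    using assms by linarith
  then show ?thesis
    using assms set_store[of m "16 * i + c" v] by (auto simp: fits_def upd_def length_store)
qed

text \<open>The existential run asserts termination and keeps every write within
  \<open>budget\<close>. Since \<open>fits\<close> is assumed before and asserted after, program
  proofs only have to bound the index and the value of each single write.\<close>

definition wp :: "cmd \<Rightarrow> ('a val list \<Rightarrow> 'a list \<Rightarrow> bool) \<Rightarrow> 'a val list \<Rightarrow> 'a list \<Rightarrow> bool" where
  "wp c Q m ys \<longleftrightarrow> (fits m \<longrightarrow> (\<exists>m' ys'. exec xs k budget c (m, ys) (m', ys') \<and> fits m' \<and> Q m' ys'))"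

lemma wp_mono:
  "wp c Q m ys \<Longrightarrow> (\<And>m' ys'. fits m' \<Longrightarrow> Q m' ys' \<Longrightarrow> Q' m' ys') \<Longrightarrow> wp c Q' m ys"
  by (auto simp: wp_def)

lemma wp_Skip: "Q m ys \<Longrightarrow> wp Skip Q m ys"
  by (auto simp: wp_def intro: exec.Skip)

lemma wp_Seq: "wp c (wp d Q) m ys \<Longrightarrow> wp (Seq c d) Q m ys"
  unfolding wp_def by (meson exec.Seq)

lemma wp_Cond:
  assumes "num (eval xs k m b) \<noteq> 0 \<Longrightarrow> wp c Q m ys" "num (eval xs k m b) = 0 \<Longrightarrow> wp d Q m ys"
  shows "wp (Cond b c d) Q m ys"
  unfolding wp_def
proof
  assume "fits m"
  then show "\<exists>m' ys'. exec xs k budget (Cond b c d) (m, ys) (m', ys') \<and> fits m' \<and> Q m' ys'"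
    using assms exec.CondTrue[of xs k "(m, ys)" b budget c _ d]
      exec.CondFalse[of xs k "(m, ys)" b budget d _ c]
    unfolding wp_def fst_conv by blast
qed

text \<open>Induction on the variant \<open>f\<close>. The obligations may assume
  \<open>fits m\<close>, so bounds on values already in memory can stay out of the
  invariant.\<close>

lemma wp_While:
  fixes f :: "'a val list \<Rightarrow> nat"
  assumes "I m ys"
    and step: "\<And>m ys. fits m \<Longrightarrow> I m ys \<Longrightarrow> num (eval xs k m b) \<noteq> 0 \<Longrightarrow>
      wp c (\<lambda>m' ys'. I m' ys' \<and> f m' < f m) m ys"
    and exit: "\<And>m ys. fits m \<Longrightarrow> I m ys \<Longrightarrow> num (eval xs k m b) = 0 \<Longrightarrow> Q m ys"
  shows "wp (While b c) Q m ys"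
  using \<open>I m ys\<close>
proof (induction "f m" arbitrary: m ys rule: less_induct)
  case less
  show ?case
    unfolding wp_def
  proof
    assume fits: "fits m"
    show "\<exists>m' ys'. exec xs k budget (While b c) (m, ys) (m', ys') \<and> fits m' \<and> Q m' ys'"
    proof (cases "num (eval xs k m b) = 0")
      case True
      then show ?thesis
        using exit[OF fits less.prems] fits exec.WhileFalse[of xs k "(m, ys)" b budget c]
        by auto
    next
      case False
      then obtain m1 ys1 where 1: "exec xs k budget c (m, ys) (m1, ys1)" "fits m1" "I m1 ys1"
          "f m1 < f m"
        using step[OF fits less.prems] fits by (auto simp: wp_def)
      obtain m2 ys2 where "exec xs k budget (While b c) (m1, ys1) (m2, ys2)" "fits m2" "Q m2 ys2"
        using less.hyps[OF 1(4,3)] 1(2) by (auto simp: wp_def)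
      then show ?thesis
        using exec.WhileTrue[of xs k "(m, ys)" b budget c "(m1, ys1)" "(m2, ys2)"] False 1(1) by auto
    qed
  qed
qed

lemma wp_Store:
  assumes "num (eval xs k m a) = 16 * i + c" "c < 16" "i < N" "num (eval xs k m e) \<le> V"
    and "Q (upd m c i (eval xs k m e)) ys"
  shows "wp (Store a e) Q m ys"
  unfolding wp_def
proof
  assume "fits m"
  then have fits: "fits (upd m c i (eval xs k m e))"
    using assms by (intro fits_upd)
  have "exec xs k budget (Store a e) (m, ys) (upd m c i (eval xs k m e), ys)"
    using fits_mem_size[OF fits] assms(1) by (intro exec.Store) (simp_all add: upd_def)
  with fits assms(5) show "\<exists>m' ys'. exec xs k budget (Store a e) (m, ys) (m', ys') \<and> fits m' \<and> Q m' ys'"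
    by blast
qed

lemma wp_set_ix:
  "c < 16 \<Longrightarrow> num (eval xs k m a) < N \<Longrightarrow> num (eval xs k m e) \<le> V \<Longrightarrow>
    Q (upd m c (num (eval xs k m a)) (eval xs k m e)) ys \<Longrightarrow> wp (set_ix c a e) Q m ys"
  unfolding set_ix_def by (rule wp_Store) simp_all

lemma wp_set_var:
  "c < 16 \<Longrightarrow> 0 < N \<Longrightarrow> num (eval xs k m e) \<le> V \<Longrightarrow> Q (upd m c 0 (eval xs k m e)) ys \<Longrightarrow>
    wp (set_var c e) Q m ys"
  unfolding set_var_def by (rule wp_Store) simp_all

lemma wp_next_ix:
  assumes "c < 16" "num (eval xs k m a) < N" "Q (upd m c (num (eval xs k m a)) (Chr y)) ys"
  shows "wp (next_ix c a) Q m (y # ys)"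
  unfolding wp_def
proof
  assume "fits m"
  then have fits: "fits (upd m c (num (eval xs k m a)) (Chr y))"
    using assms by (intro fits_upd) auto
  have "exec xs k budget (next_ix c a) (m, y # ys) (upd m c (num (eval xs k m a)) (Chr y), ys)"
    using fits_mem_size[OF fits] unfolding next_ix_def
    by (intro exec.Next) (simp_all add: upd_def)
  with fits assms(3) show "\<exists>m' ys'. exec xs k budget (next_ix c a) (m, y # ys) (m', ys') \<and> fits m' \<and> Q m' ys'"
    by blast
qed

end

section \<open>The program\<close>

text \<open>The output has to be array 0, because entry 0 of that array is cell 0.\<close>

abbreviation (input) vOut :: nat where "vOut \<equiv> 0"
abbreviation (input) vSide :: nat where "vSide \<equiv> 10"
abbreviation (input) vTop :: nat where "vTop \<equiv> 2"
abbreviation (input) vRound :: nat where "vRound \<equiv> 3"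
abbreviation (input) vRead :: nat where "vRead \<equiv> 4"
abbreviation (input) vI :: nat where "vI \<equiv> 5"
abbreviation (input) vJ :: nat where "vJ \<equiv> 6"
abbreviation (input) vPos :: nat where "vPos \<equiv> 7"
abbreviation (input) vDiag :: nat where "vDiag \<equiv> 8"
abbreviation (input) vTmp :: nat where "vTmp \<equiv> 9"
abbreviation (input) vLen :: nat where "vLen \<equiv> 11"
abbreviation (input) aBlock :: nat where "aBlock \<equiv> 12"
abbreviation (input) aRow :: nat where "aRow \<equiv> 13"
abbreviation (input) aLev :: nat where "aLev \<equiv> 14"
abbreviation (input) aTab :: nat where "aTab \<equiv> 15"

definition succ :: "expr \<Rightarrow> expr" where
  "succ e = Add e (Const 1)"

text \<open>Truncated subtraction makes this the maximum.\<close>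

definition mx :: "expr \<Rightarrow> expr \<Rightarrow> expr" where
  "mx e f = Add e (Sub f e)"

definition inc :: "nat \<Rightarrow> cmd" where
  "inc c = set_var c (succ (var c))"

lemma eval_succ [simp]: "eval xs k m (succ e) = Num (Suc (num (eval xs k m e)))"
  by (simp add: succ_def)

lemma eval_mx [simp]: "eval xs k m (mx e f) = Num (max (num (eval xs k m e)) (num (eval xs k m f)))"
  by (simp add: mx_def max_def)

definition side_prog :: cmd where
  "side_prog = While (Less (Mul (var vSide) (var vSide)) Len) (inc vSide)"

text \<open>Only entries from 1 on are written: unallocated cells read as 0, the right level and
  prefix for index 0. The default \<open>Len + 1\<close> marks a level without known prefix.\<close>

definition levels_prog :: cmd where
  "levels_prog = While (Less (ix aLev (var vTop)) Len)
     (Seq (set_ix aLev (succ (var vTop))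
        (Add (succ (ix aLev (var vTop))) (Div (ix aLev (var vTop)) (Mul Prec (var vSide)))))
     (Seq (set_ix aTab (succ (var vTop)) (succ Len))
     (inc vTop)))"

text \<open>The product of comparisons is their conjunction. Its second factor stops at the end of
  the stream when a block is short or empty.\<close>

definition read_prog :: cmd where
  "read_prog = Seq (set_var vLen (Const 0))
     (While (Mul (Less (var vLen) (var vSide)) (Less (var vRead) Len))
       (Seq (next_ix aBlock (var vLen)) (Seq (inc vLen) (inc vRead))))"

definition clear_prog :: cmd where
  "clear_prog = Seq (set_var vI (Const 0))
     (While (Less (var vI) (succ (var vLen))) (Seq (set_ix aRow (var vI) (Const 0)) (inc vI)))"

definition row_expr :: expr where
  "row_expr = mx (mx (ix aRow (succ (var vI))) (ix aRow (var vI)))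
     (Mul (Eq (ix aBlock (var vI)) (Off (var vPos))) (succ (var vDiag)))"

text \<open>A single array is overwritten from one row to the next. \<open>vTmp\<close> saves the
  old entry at \<open>vI + 1\<close>, which is the diagonal entry for the following column.\<close>

definition row_prog :: cmd where
  "row_prog = Seq (set_var vI (Const 0)) (Seq (set_var vDiag (Const 0))
     (While (Less (var vI) (var vLen))
       (Seq (set_var vTmp (ix aRow (succ (var vI))))
       (Seq (set_ix aRow (succ (var vI)) row_expr)
       (Seq (set_var vDiag (var vTmp)) (inc vI))))))"

definition relax_prog :: cmd where
  "relax_prog = Seq (set_var vI (var vJ))
     (While (Less (var vI) (succ (var vTop)))
       (Seq (Cond (Mul (Less (ix aLev (var vI)) (succ (Add (ix aLev (var vJ)) (ix aRow (var vLen)))))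
                       (Less (var vPos) (ix aTab (var vI))))
               (set_ix aTab (var vI) (var vPos)) Skip)
       (inc vI)))"

text \<open>For a level without known prefix, \<open>vPos\<close> starts beyond \<open>Len\<close>
  and the loop does nothing.\<close>

definition scan_prog :: cmd where
  "scan_prog = Seq clear_prog (Seq (set_var vPos (ix aTab (var vJ)))
     (While (Less (var vPos) Len) (Seq row_prog (Seq (inc vPos) relax_prog))))"

definition block_prog :: cmd where
  "block_prog = Seq (set_var vJ (succ (var vTop)))
     (While (Less (Const 0) (var vJ))
       (Seq (set_var vJ (Sub (var vJ) (Const 1))) scan_prog))"

definition rounds_prog :: cmd where
  "rounds_prog = While (Less (var vRound) (var vSide))
     (Seq read_prog (Seq block_prog (inc vRound)))"

text \<open>
  Adding 0 makes the stored value a number by construction, which saves an invariant excluding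
  characters from the array of levels.
\<close>

definition output_prog :: cmd where
  "output_prog = Seq (set_var vJ (Const 0))
     (While (Less (var vJ) (succ (var vTop)))
       (Seq (Cond (Less (ix aTab (var vJ)) (succ Len)) (set_var vOut (Add (ix aLev (var vJ)) (Const 0))) Skip)
       (inc vJ)))"

definition lcs_prog :: cmd where
  "lcs_prog = Cond (Mul Len (Less (Const 1) Prec))
     (Seq side_prog (Seq levels_prog (Seq rounds_prog output_prog))) Skip"

section \<open>Correctness of the program\<close>

locale lcs_run =
  fixes xs s :: "'a list" and k :: nat
  assumes length_s: "length s = length xs" and xs_ne: "xs \<noteq> []" and k_pos: "k > 0"
begin

definition side :: nat where
  "side = (LEAST r. length xs \<le> r * r)"

definition M :: nat where
  "M = k * side"

definition height :: nat where
  "height = (LEAST j. length xs \<le> lev M j)"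

lemma length_pos: "length xs > 0"
  using xs_ne by simp

lemma side_square: "length xs \<le> side * side"
  unfolding side_def by (rule LeastI[of _ "length xs"]) (rule le_square)

lemma below_side: "r < side \<Longrightarrow> r * r < length xs"
  unfolding side_def using not_less_Least not_le by blast

lemma side_le: "side \<le> length xs"
  unfolding side_def by (rule Least_le) (rule le_square)

lemma side_pos: "side > 0"
  using side_square length_pos by (cases side) auto

lemma M_pos: "M > 0"
  using side_pos k_pos by (simp add: M_def)

lemma lev_height: "length xs \<le> lev M height"
  unfolding height_def by (rule LeastI[of _ "length xs"]) (rule lev_ge)

lemma height_le: "length xs \<le> lev M j \<Longrightarrow> height \<le> j"
  unfolding height_def by (rule Least_le)

lemma height_le_length: "height \<le> length xs"
  by (rule height_le) (rule lev_ge)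

text \<open>The top level may overshoot \<open>n\<close>, but a step from \<open>l\<close> adds at
  most \<open>l + 1\<close>.\<close>

lemma lev_Suc_le:
  assumes "lev M j < length xs"
  shows "lev M (Suc j) \<le> 2 * length xs"
  using assms div_le_dividend[of "lev M j" M] lev.simps(2)[of M j] by linarith

end

text \<open>Levels and table use indices up to \<open>height\<close>, block and row indices up to
  \<open>side\<close>. Levels are at most \<open>2 * n\<close> by \<open>lev_Suc_le\<close>; table
  entries, positions and counters are at most \<open>n + 1\<close>.\<close>

sublocale lcs_run \<subseteq> machine xs k "height + side + 2" "2 * length xs + 2" .

context lcs_run
begin

section \<open>Invariants and initialisation\<close>

lemmas wp_rules = wp_Seq wp_set_var wp_set_ix

definition base :: "'a val list \<Rightarrow> bool" where
  "base m \<longleftrightarrow> narr m vSide 0 = side \<and> narr m vTop 0 = height \<and>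
     (\<forall>j\<le>height. narr m aLev j = lev M j)"

definition holds_block :: "'a list \<Rightarrow> 'a val list \<Rightarrow> bool" where
  "holds_block bs m \<longleftrightarrow> narr m vLen 0 = length bs \<and> length bs \<le> side \<and>
     (\<forall>i<length bs. arr m aBlock i = Chr (bs ! i))"

lemma base_unchanged:
  "base m \<Longrightarrow> unchanged C m m' \<Longrightarrow> vSide \<notin> C \<Longrightarrow> vTop \<notin> C \<Longrightarrow> aLev \<notin> C \<Longrightarrow> base m'"
  by (simp add: base_def unchanged_def)

lemma holds_block_unchanged:
  "holds_block bs m \<Longrightarrow> unchanged C m m' \<Longrightarrow> vLen \<notin> C \<Longrightarrow> aBlock \<notin> C \<Longrightarrow> holds_block bs m'"
  by (simp add: holds_block_def unchanged_def)

lemma wp_side_prog: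
  assumes "narr m vSide 0 = 0"
  shows "wp side_prog (\<lambda>m' ys'. ys' = ys \<and> unchanged {vSide} m m' \<and> narr m' vSide 0 = side) m ys"
  unfolding side_prog_def
proof (rule wp_While[where I = "\<lambda>m' ys'. ys' = ys \<and> unchanged {vSide} m m' \<and> narr m' vSide 0 \<le> side"
      and f = "\<lambda>m'. side - narr m' vSide 0"], goal_cases)
  case 1
  then show ?case using assms by simp
next
  case (2 m' ys')
  then have "narr m' vSide 0 \<noteq> side"
    using side_square by auto
  then show ?case
    using 2 side_le unfolding inc_def by (intro wp_rules) auto
next
  case (3 m' ys')
  then have "\<not> narr m' vSide 0 < side"
    using below_side by auto
  then show ?case using 3 by auto
qed

definition initial_table :: "nat \<Rightarrow> nat" where
  "initial_table j = (if j = 0 then 0 else Suc (length xs))"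

lemma wp_levels_prog:
  assumes side: "narr m vSide 0 = side" and "narr m vTop 0 = 0" "narr m aLev 0 = 0" "narr m aTab 0 = 0"
  shows "wp levels_prog (\<lambda>m' ys'. ys' = ys \<and> unchanged {vTop, aLev, aTab} m m' \<and> base m' \<and>
      (\<forall>j\<le>height. narr m' aTab j = initial_table j)) m ys"
  unfolding levels_prog_def
proof (rule wp_While[where I = "\<lambda>m' ys'. ys' = ys \<and> unchanged {vTop, aLev, aTab} m m' \<and>
      narr m' vTop 0 \<le> height \<and>
      (\<forall>j\<le>narr m' vTop 0. narr m' aLev j = lev M j \<and> narr m' aTab j = initial_table j)"
      and f = "\<lambda>m'. height - narr m' vTop 0"], goal_cases)
  case 1
  then show ?case using assms by (simp add: initial_table_def)
next
  case (2 m' ys')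
  let ?j = "narr m' vTop 0"
  have lt: "lev M ?j < length xs"
    using 2 by (auto split: if_splits)
  then have j: "?j < height"
    using lev_height strict_mono_less[OF strict_mono_lev, of M ?j height] by linarith
  have s: "narr m' vSide 0 = side"
    using 2 side by (auto simp: unchangedD)
  show ?case
    using 2 j s lev_Suc_le[OF lt] height_le_length unfolding inc_def
    by (intro wp_rules) (auto simp: initial_table_def M_def le_Suc_eq)
next
  case (3 m' ys')
  let ?j = "narr m' vTop 0"
  have "length xs \<le> lev M ?j"
    using 3 by (auto split: if_splits)
  then have "?j = height"
    using 3 height_le[of ?j] by auto
  moreover have "narr m' vSide 0 = side"
    using 3 side by (auto simp: unchangedD)
  ultimately show ?case
    using 3 by (auto simp: base_def)
qed

section \<open>Reading a block and computing one row\<close>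

lemma wp_read_prog:
  assumes base: "base m" and rd: "narr m vRead 0 = r" "r \<le> length s" and ys: "ys = drop r s"
  shows "wp read_prog (\<lambda>m' ys'. unchanged {vLen, vRead, aBlock} m m' \<and>
      holds_block (take side (drop r s)) m' \<and> narr m' vRead 0 = min (length s) (r + side) \<and>
      ys' = drop (min (length s) (r + side)) s) m ys"
  unfolding read_prog_def
proof (intro wp_rules, goal_cases)
  case 4
  show ?case
  proof (rule wp_While[where I = "\<lambda>m' ys'. unchanged {vLen, vRead, aBlock} m m' \<and>
      narr m' vLen 0 \<le> side \<and> narr m' vRead 0 = r + narr m' vLen 0 \<and> narr m' vRead 0 \<le> length s \<and>
      ys' = drop (narr m' vRead 0) s \<and> (\<forall>i<narr m' vLen 0. arr m' aBlock i = Chr (s ! (r + i)))"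
      and f = "\<lambda>m'. side - narr m' vLen 0"], goal_cases)
    case 1
    then show ?case using rd ys by simp
  next
    case (2 m' ys')
    let ?l = "narr m' vLen 0"
    have s: "narr m' vSide 0 = side"
      using 2 base by (auto simp: unchangedD base_def)
    have l: "?l < side" "r + ?l < length s"
      using 2 s by (auto simp: length_s split: if_splits)
    \<comment> \<open>\<open>Next\<close> can only run on a non-empty stream, so its head is
      exhibited.\<close>
    then have ys': "ys' = s ! (r + ?l) # drop (Suc (r + ?l)) s"
      using 2 by (simp add: Cons_nth_drop_Suc)
    show ?case
      unfolding ys' inc_def
      using 2 s l side_le length_s
      by (intro wp_Seq wp_next_ix wp_set_var) (auto simp: less_Suc_eq)
  next
    case (3 m' ys')
    let ?l = "narr m' vLen 0"
    have "narr m' vSide 0 = side"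
      using 3 base by (auto simp: unchangedD base_def)
    then have "?l = min side (length s - r)"
      using 3 by (auto simp: length_s split: if_splits)
    then show ?case
      using 3 by (auto simp: holds_block_def min_def)
  qed
qed auto

lemma wp_clear_prog:
  assumes block: "holds_block bs m"
  shows "wp clear_prog (\<lambda>m' ys'. ys' = ys \<and> unchanged {vI, aRow} m m' \<and>
      (\<forall>i\<le>length bs. narr m' aRow i = 0)) m ys"
  unfolding clear_prog_def
proof (intro wp_rules, goal_cases)
  case 4
  show ?case
  proof (rule wp_While[where I = "\<lambda>m' ys'. ys' = ys \<and> unchanged {vI, aRow} m m' \<and>
      narr m' vI 0 \<le> Suc (length bs) \<and> (\<forall>i<narr m' vI 0. narr m' aRow i = 0)"
      and f = "\<lambda>m'. Suc (length bs) - narr m' vI 0"], goal_cases)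
    case (2 m' ys')
    have l: "narr m' vLen 0 = length bs" "length bs \<le> side"
      using 2 block by (auto simp: unchangedD holds_block_def)
    then show ?case
      using 2 side_le unfolding inc_def by (intro wp_rules) (auto simp: less_Suc_eq split: if_splits)
  next
    case (3 m' ys')
    have "narr m' vLen 0 = length bs"
      using 3 block by (auto simp: unchangedD holds_block_def)
    then show ?case using 3 by (auto split: if_splits)
  qed simp
qed auto

lemma wp_row_prog:
  assumes block: "holds_block bs m" and p: "narr m vPos 0 = p" "p < length xs" "t \<le> p"
    and row: "\<forall>i\<le>length bs. narr m aRow i = row xs bs t p i"
  shows "wp row_prog (\<lambda>m' ys'. ys' = ys \<and> unchanged {vI, vDiag, vTmp, aRow} m m' \<and>
      (\<forall>i\<le>length bs. narr m' aRow i = row xs bs t (Suc p) i)) m ys"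
  unfolding row_prog_def
proof (intro wp_rules, goal_cases)
  case 7
  show ?case
  \<comment> \<open>Entries up to \<open>vI\<close> already belong to row \<open>Suc p\<close>, the
    others still to row \<open>p\<close>. Entry 0 is 0 in both rows, so this holds at the
    start.\<close>
  proof (rule wp_While[where I = "\<lambda>m' ys'. ys' = ys \<and> unchanged {vI, vDiag, vTmp, aRow} m m' \<and>
      narr m' vI 0 \<le> length bs \<and> narr m' vDiag 0 = row xs bs t p (narr m' vI 0) \<and>
      (\<forall>i\<le>length bs. narr m' aRow i = row xs bs t (if i \<le> narr m' vI 0 then Suc p else p) i)"
      and f = "\<lambda>m'. length bs - narr m' vI 0"], goal_cases)
    case 1
    then show ?case using row by simp
  next
    case (2 m' ys')
    let ?i = "narr m' vI 0"
    have l: "narr m' vLen 0 = length bs" "length bs \<le> side"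
      using 2 block by (auto simp: unchangedD holds_block_def)
    have i: "?i < length bs"
      using 2 l by (auto split: if_splits)
    have b: "arr m' aBlock ?i = Chr (bs ! ?i)" "narr m' vPos 0 = p"
      using 2 i block p by (auto simp: unchangedD holds_block_def)
    have d: "narr m' vDiag 0 = row xs bs t p ?i" "narr m' aRow ?i = row xs bs t (Suc p) ?i"
        "narr m' aRow (Suc ?i) = row xs bs t p (Suc ?i)"
      using 2 i by (auto simp del: row.simps)
    \<comment> \<open>Arbitrary \<open>v\<close>, because \<open>row_expr\<close> is evaluated after
      the old entry has been saved in \<open>vTmp\<close>.\<close>
    have ev: "eval xs k (upd m' vTmp 0 v) row_expr = Num (row xs bs t (Suc p) (Suc ?i))" for v
      using p b d by (simp add: row_expr_def)
    have le: "row xs bs t p (Suc ?i) \<le> 2 * length xs + 2"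
        "row xs bs t (Suc p) (Suc ?i) \<le> 2 * length xs + 2"
      using row_le[of xs bs t p "Suc ?i"] row_le[of xs bs t "Suc p" "Suc ?i"] i l side_le
      by linarith+
    show ?case
      using 2 i l le d side_le unfolding inc_def
      by (intro wp_rules) (auto simp del: row.simps simp: ev le_Suc_eq)
  next
    case (3 m' ys')
    have "narr m' vLen 0 = length bs"
      using 3 block by (auto simp: unchangedD holds_block_def)
    then show ?case using 3 by (auto split: if_splits)
  qed
qed auto

section \<open>Updating the table with one block\<close>

lemma wp_relax_prog:
  assumes base: "base m" and j: "narr m vJ 0 = j" "j \<le> height" and p: "narr m vPos 0 = p"
    and d: "narr m aRow (narr m vLen 0) = d"
  shows "wp relax_prog (\<lambda>m' ys'. ys' = ys \<and> unchanged {vI, aTab} m m' \<and>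
      (\<forall>l\<le>height. narr m' aTab l =
        (if j \<le> l \<and> lev M l \<le> lev M j + d then min (narr m aTab l) p else narr m aTab l))) m ys"
  unfolding relax_prog_def
proof (intro wp_rules, goal_cases)
  case 3
  then show ?case using j height_le_length by simp
next
  case 4
  show ?case
  proof (rule wp_While[where I = "\<lambda>m' ys'. ys' = ys \<and> unchanged {vI, aTab} m m' \<and>
      j \<le> narr m' vI 0 \<and> narr m' vI 0 \<le> Suc height \<and>
      (\<forall>l\<le>height. narr m' aTab l = (if j \<le> l \<and> l < narr m' vI 0 \<and> lev M l \<le> lev M j + d
         then min (narr m aTab l) p else narr m aTab l))"
      and f = "\<lambda>m'. Suc height - narr m' vI 0"], goal_cases)
    case 1
    then show ?case using j by simp
  next
    case (2 m' ys')
    let ?i = "narr m' vI 0"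
    have u: "unchanged {vI, aTab} m m'"
      using 2 by simp
    have eqs: "narr m' vJ 0 = j" "narr m' vPos 0 = p" "narr m' aRow (narr m' vLen 0) = d"
        "narr m' vTop 0 = height"
      using base j p d by (auto simp: unchangedD[OF u] base_def)
    have i: "?i \<le> height"
      using 2 eqs by (auto split: if_splits)
    have lv: "narr m' aLev ?i = lev M ?i" "narr m' aLev j = lev M j"
      using base i j by (auto simp: unchangedD[OF u] base_def)
    have t: "narr m' aTab ?i = narr m aTab ?i"
      using 2 i by simp
    \<comment> \<open>The position is already in memory, so \<open>fits\<close> bounds it.\<close>
    have V: "p \<le> 2 * length xs + 2"
      using fits_narr[of m' vPos 0] 2 eqs by simp
    show ?case
    proof (intro wp_Seq wp_Cond, goal_cases)
      case 1
      then have "lev M ?i \<le> lev M j + d" "p < narr m aTab ?i"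
        using eqs lv t by (auto split: if_splits)
      then show ?case
        using 2 i eqs V height_le_length unfolding inc_def
        by (intro wp_rules) (auto simp: less_Suc_eq)
    next
      case n: 2
      then have "\<not> lev M ?i \<le> lev M j + d \<or> narr m aTab ?i \<le> p"
        using eqs lv t by (auto split: if_splits)
      then show ?case
        using 2 i height_le_length unfolding inc_def
        by (intro wp_rules wp_Skip) (auto simp: less_Suc_eq)
    qed
  next
    case (3 m' ys')
    have "narr m' vTop 0 = height"
      using 3 base by (auto simp: unchangedD base_def)
    then show ?case using 3 by (auto split: if_splits)
  qed
qed auto

text \<open>Two readings of the table coexist. Entry \<open>j\<close> is still witnessed by the
  stream \<open>us\<close> before the block, so adding the row uses no block character twice; all
  entries are sound for \<open>us @ bs\<close>.\<close>

lemma wp_scan_prog: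
  assumes base: "base m" and block: "holds_block bs m" and j: "narr m vJ 0 = j" "j \<le> height"
    and T: "\<forall>l\<le>height. narr m aTab l = T l" "\<forall>l\<le>height. T l \<le> Suc (length xs)"
    and old: "T j \<le> length xs \<longrightarrow> reach xs us (T j) (lev M j)"
    and new: "sound_table xs M height (us @ bs) T"
  shows "wp scan_prog (\<lambda>m' ys'. ys' = ys \<and>
      unchanged {vI, vPos, vDiag, vTmp, aRow, aTab} m m' \<and>
      (\<forall>l\<le>height. narr m' aTab l \<le> T l) \<and> (\<forall>l<j. narr m' aTab l = T l) \<and>
      sound_table xs M height (us @ bs) (narr m' aTab) \<and>
      (\<forall>p l. j \<le> l \<longrightarrow> l \<le> height \<longrightarrow> T j \<le> p \<longrightarrow> p \<le> length xs \<longrightarrow>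
        lev M l \<le> lev M j + row xs bs (T j) p (length bs) \<longrightarrow> narr m' aTab l \<le> p)) m ys"
  unfolding scan_prog_def
proof (rule wp_Seq, rule wp_mono[OF wp_clear_prog[OF block]], elim conjE, goal_cases)
  case (1 m1 ys1)
  note u1 = unchangedD[OF 1(3)]
  have start: "narr m1 vJ 0 = j" "narr m1 aTab j = T j" "T j \<le> Suc (length xs)"
    using j T by (auto simp: u1)
  show ?case
  proof (intro wp_rules, goal_cases)
    case 3
    then show ?case using start by simp
  next
    case 4
    show ?case
    proof (rule wp_While[where I = "\<lambda>m' ys'. ys' = ys \<and>
      unchanged {vI, vPos, vDiag, vTmp, aRow, aTab} m m' \<and> T j \<le> narr m' vPos 0 \<and>
      (\<forall>i\<le>length bs. narr m' aRow i = row xs bs (T j) (narr m' vPos 0) i) \<and>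
      (\<forall>l\<le>height. narr m' aTab l \<le> T l) \<and> (\<forall>l<j. narr m' aTab l = T l) \<and>
      sound_table xs M height (us @ bs) (narr m' aTab) \<and>
      (\<forall>p l. j \<le> l \<longrightarrow> l \<le> height \<longrightarrow> T j \<le> p \<longrightarrow> p \<le> narr m' vPos 0 \<longrightarrow>
        lev M l \<le> lev M j + row xs bs (T j) p (length bs) \<longrightarrow> narr m' aTab l \<le> p)"
      and f = "\<lambda>m'. length xs - narr m' vPos 0"], goal_cases)
      case I: 1
      have "unchanged {vI, vPos, vDiag, vTmp, aRow, aTab} m m1"
        using 1(3) by (auto simp: unchanged_def)
      \<comment> \<open>At the start position the row vanishes, so the completeness clause can only
        concern \<open>j\<close> itself.\<close>
      moreover have "l = j" if "j \<le> l" "lev M l \<le> lev M j" for l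
        using that by (simp add: strict_mono_less_eq[OF strict_mono_lev])
      moreover have "sound_table xs M height (us @ bs) (narr m1 aTab)"
        using new T by (simp add: sound_table_def u1)
      ultimately show ?case
        using 1 T start j by (auto simp: u1 sound_table_def)
    next
      case (2 m' ys')
      define p where "p = narr m' vPos 0"
      have u: "unchanged {vI, vPos, vDiag, vTmp, aRow, aTab} m m'" and ys': "ys' = ys"
        and Tp: "T j \<le> p" and row: "\<forall>i\<le>length bs. narr m' aRow i = row xs bs (T j) p i"
        and le: "\<forall>l\<le>height. narr m' aTab l \<le> T l" and eq: "\<forall>l<j. narr m' aTab l = T l"
        and snd: "sound_table xs M height (us @ bs) (narr m' aTab)"
        and cpl: "\<forall>q l. j \<le> l \<longrightarrow> l \<le> height \<longrightarrow> T j \<le> q \<longrightarrow> q \<le> p \<longrightarrow>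
          lev M l \<le> lev M j + row xs bs (T j) q (length bs) \<longrightarrow> narr m' aTab l \<le> q"
        using 2 by (auto simp: p_def)
      have p: "p < length xs"
        using 2 by (auto simp: p_def split: if_splits)
      have base': "base m'" and block': "holds_block bs m'"
        using base_unchanged[OF base u] holds_block_unchanged[OF block u] by auto
      show ?case
        unfolding ys'
      proof (rule wp_Seq, rule wp_mono[OF wp_row_prog[OF block' p_def[symmetric] p Tp row]],
          elim conjE, goal_cases)
        case (1 m2 ys2)
        note u2 = unchangedD[OF 1(3)]
        let ?m = "upd m2 vPos 0 (Num (Suc p))"
        let ?d = "row xs bs (T j) (Suc p) (length bs)"
        have p2: "narr m2 vPos 0 = p"
          by (simp add: u2 p_def)
        have u3: "unchanged {vI, vPos, vDiag, vTmp, aRow, aTab} m' ?m"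
          using 1(3) by (auto simp: unchanged_def)
        have um: "unchanged {vI, vPos, vDiag, vTmp, aRow, aTab} m ?m"
          by (rule unchanged_trans[OF u u3]) auto
        have base2: "base ?m" and block2: "holds_block bs ?m"
          using base_unchanged[OF base um] holds_block_unchanged[OF block um] by auto
        have j2: "narr ?m vJ 0 = j"
          using j unchangedD[OF um, of vJ] by simp
        have d2: "narr ?m aRow (narr ?m vLen 0) = ?d"
          using 1(4) block2 by (simp add: holds_block_def del: row.simps)
        have tab2: "narr ?m aTab l = narr m' aTab l" for l
          by (simp add: u2)
        have r: "reach xs (us @ bs) (Suc p) (lev M j + ?d)"
          using reach_row[of xs us "T j" "lev M j" "Suc p" "length bs" bs] old Tp p by simp
        have relax: "wp relax_prog (\<lambda>m'' ys''. ys'' = ys \<and> unchanged {vI, aTab} ?m m'' \<and>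
          (\<forall>l\<le>height. narr m'' aTab l = (if j \<le> l \<and> lev M l \<le> lev M j + ?d
            then min (narr ?m aTab l) (Suc p) else narr ?m aTab l))) ?m ys"
          by (rule wp_relax_prog[OF base2 j2 j(2) _ d2]) simp
        have "wp relax_prog (\<lambda>m'' ys''. (ys'' = ys \<and>
            unchanged {vI, vPos, vDiag, vTmp, aRow, aTab} m m'' \<and> T j \<le> narr m'' vPos 0 \<and>
            (\<forall>i\<le>length bs. narr m'' aRow i = row xs bs (T j) (narr m'' vPos 0) i) \<and>
            (\<forall>l\<le>height. narr m'' aTab l \<le> T l) \<and> (\<forall>l<j. narr m'' aTab l = T l) \<and>
            sound_table xs M height (us @ bs) (narr m'' aTab) \<and>
            (\<forall>q l. j \<le> l \<longrightarrow> l \<le> height \<longrightarrow> T j \<le> q \<longrightarrow> q \<le> narr m'' vPos 0 \<longrightarrow>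
              lev M l \<le> lev M j + row xs bs (T j) q (length bs) \<longrightarrow> narr m'' aTab l \<le> q)) \<and>
            length xs - narr m'' vPos 0 < length xs - narr m' vPos 0) ?m ys"
        proof (rule wp_mono[OF relax], elim conjE, goal_cases)
          case (1 m3 ys3)
          note u3 = unchangedD[OF 1(3)]
          have tab3: "\<forall>l\<le>height. narr m3 aTab l = (if j \<le> l \<and> lev M l \<le> lev M j + ?d
            then min (narr m' aTab l) (Suc p) else narr m' aTab l)"
            using 1(4) unfolding tab2 .
          have pos3: "narr m3 vPos 0 = Suc p"
            by (simp add: u3)
          have row3: "\<forall>i\<le>length bs. narr m3 aRow i = row xs bs (T j) (Suc p) i"
            using \<open>\<forall>i\<le>length bs. narr m2 aRow i = row xs bs (T j) (Suc p) i\<close>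
            by (simp add: u3 del: row.simps)
          have "sound_table xs M height (us @ bs) (narr m3 aTab)"
            unfolding sound_table_def
          proof (intro allI impI)
            fix l assume l: "l \<le> height" "narr m3 aTab l \<le> length xs"
            show "reach xs (us @ bs) (narr m3 aTab l) (lev M l)"
            proof (cases "narr m3 aTab l = narr m' aTab l")
              case True
              then show ?thesis using snd l by (simp add: sound_table_def)
            next
              case False
              then have "lev M l \<le> lev M j + ?d" "narr m3 aTab l = Suc p"
                using tab3 l by (auto simp: min_def simp del: row.simps split: if_splits)
              \<comment> \<open>The entry was lowered to \<open>Suc p\<close>, where
                \<open>lev M j + ?d\<close> is reachable; smaller lengths follow by downward
                closure.\<close>
              then show ?thesis
                using r by (simp add: reach_iff_le_lcs del: row.simps)
            qed
          qed
          moreover have "narr m3 aTab l \<le> q" if "j \<le> l" "l \<le> height" "T j \<le> q" "q \<le> Suc p"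
              "lev M l \<le> lev M j + row xs bs (T j) q (length bs)" for q l
          \<comment> \<open>The new position is handled by this relaxation; smaller ones were
            handled before, and entries only decrease.\<close>
          proof (cases "q = Suc p")
            case True
            then show ?thesis using that tab3 by (simp del: row.simps)
          next
            case False
            then have "narr m' aTab l \<le> q" using that cpl by simp
            moreover have "narr m3 aTab l \<le> narr m' aTab l"
              using that tab3 by (simp del: row.simps)
            ultimately show ?thesis by simp
          qed
          moreover have "\<forall>l\<le>height. narr m3 aTab l \<le> T l"
            using tab3 le by (auto simp: min.coboundedI1 simp del: row.simps)
          moreover have "\<forall>l<j. narr m3 aTab l = T l"
            using tab3 eq j by (simp del: row.simps)
          moreover have "unchanged {vI, vPos, vDiag, vTmp, aRow, aTab} m m3"
            by (rule unchanged_trans[OF um 1(3)]) auto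
          moreover have "length xs - Suc p < length xs - narr m' vPos 0"
            using p by (simp add: p_def)
          ultimately show ?case
            using row3 Tp 1(2) by (simp add: pos3 del: row.simps)
        qed
        then show ?case
          using 1(2) p p2 unfolding inc_def by (intro wp_rules) simp_all
      qed
    next
      case (3 m' ys')
      then have "length xs \<le> narr m' vPos 0"
        by (auto split: if_splits)
      then show ?case using 3 by simp
    qed
  qed auto
qed

text \<open>The invariant keeps all entries below \<open>vJ\<close> as they were before the block.
  Hence each level is scanned from its original prefix, and the premise of
  \<open>complete_table_block\<close> accumulates from the top level down.\<close>

lemma wp_block_prog:
  assumes base: "base m" and block: "holds_block bs m"
    and le: "\<forall>l\<le>height. narr m aTab l \<le> Suc (length xs)"
    and snd: "sound_table xs M height us (narr m aTab)"
    and cpl: "complete_table \<alpha> xs M height us (narr m aTab)" and \<alpha>: "\<alpha> \<le> 1"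
  shows "wp block_prog (\<lambda>m' ys'. ys' = ys \<and>
      unchanged {vI, vJ, vPos, vDiag, vTmp, aRow, aTab} m m' \<and>
      (\<forall>l\<le>height. narr m' aTab l \<le> Suc (length xs)) \<and>
      sound_table xs M height (us @ bs) (narr m' aTab) \<and>
      complete_table (\<alpha> * (real M / real (M + 1))) xs M height (us @ bs) (narr m' aTab)) m ys"
  unfolding block_prog_def
proof (intro wp_rules, goal_cases)
  case 3
  then show ?case using base height_le_length by (simp add: base_def)
next
  case 4
  let ?T = "narr m aTab"
  show ?case
  proof (rule wp_While[where I = "\<lambda>m' ys'. ys' = ys \<and>
      unchanged {vI, vJ, vPos, vDiag, vTmp, aRow, aTab} m m' \<and> narr m' vJ 0 \<le> Suc height \<and>
      (\<forall>l\<le>height. narr m' aTab l \<le> ?T l) \<and> (\<forall>l<narr m' vJ 0. narr m' aTab l = ?T l) \<and>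
      sound_table xs M height (us @ bs) (narr m' aTab) \<and>
      (\<forall>j p l. narr m' vJ 0 \<le> j \<longrightarrow> j \<le> l \<longrightarrow> l \<le> height \<longrightarrow> ?T j \<le> p \<longrightarrow> p \<le> length xs \<longrightarrow>
        lev M l \<le> lev M j + row xs bs (?T j) p (length bs) \<longrightarrow> narr m' aTab l \<le> p)"
      and f = "\<lambda>m'. narr m' vJ 0"], goal_cases)
    case 1
    have "sound_table xs M height (us @ bs) ?T"
      using snd by (auto simp: sound_table_def intro: reach_mono)
    then show ?case
      using base by (simp add: base_def sound_table_def)
  next
    case (2 m' ys')
    let ?j = "narr m' vJ 0 - 1"
    let ?m = "upd m' vJ 0 (Num ?j)"
    have u: "unchanged {vI, vJ, vPos, vDiag, vTmp, aRow, aTab} m m'" and ys': "ys' = ys"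
      and j: "0 < narr m' vJ 0" "narr m' vJ 0 \<le> Suc height"
      and le': "\<forall>l\<le>height. narr m' aTab l \<le> ?T l" and eq: "\<forall>l<narr m' vJ 0. narr m' aTab l = ?T l"
      and snd': "sound_table xs M height (us @ bs) (narr m' aTab)"
      and cpl': "\<forall>j p l. narr m' vJ 0 \<le> j \<longrightarrow> j \<le> l \<longrightarrow> l \<le> height \<longrightarrow> ?T j \<le> p \<longrightarrow> p \<le> length xs \<longrightarrow>
        lev M l \<le> lev M j + row xs bs (?T j) p (length bs) \<longrightarrow> narr m' aTab l \<le> p"
      using 2 by (auto split: if_splits)
    have um: "unchanged {vI, vJ, vPos, vDiag, vTmp, aRow, aTab} m ?m"
      using u by simp
    have base': "base ?m" and block': "holds_block bs ?m"
      using base_unchanged[OF base um] holds_block_unchanged[OF block um] by auto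
    have jh: "?j \<le> height" "narr m' aTab ?j = ?T ?j"
      using j eq by auto
    have T': "\<forall>l\<le>height. narr ?m aTab l = narr m' aTab l"
      by simp
    have le2: "\<forall>l\<le>height. narr m' aTab l \<le> Suc (length xs)"
      using le le' order_trans by blast
    have old: "narr m' aTab ?j \<le> length xs \<longrightarrow> reach xs us (narr m' aTab ?j) (lev M ?j)"
      using snd jh by (simp add: sound_table_def)
    have "narr ?m vJ 0 = ?j"
      by simp
    note scan = wp_scan_prog[where T = "narr m' aTab" and us = us, OF base' block' this jh(1) T' le2 old snd', of ys]
    have "wp scan_prog (\<lambda>m'' ys''. (ys'' = ys \<and>
      unchanged {vI, vJ, vPos, vDiag, vTmp, aRow, aTab} m m'' \<and> narr m'' vJ 0 \<le> Suc height \<and>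
      (\<forall>l\<le>height. narr m'' aTab l \<le> ?T l) \<and> (\<forall>l<narr m'' vJ 0. narr m'' aTab l = ?T l) \<and>
      sound_table xs M height (us @ bs) (narr m'' aTab) \<and>
      (\<forall>j p l. narr m'' vJ 0 \<le> j \<longrightarrow> j \<le> l \<longrightarrow> l \<le> height \<longrightarrow> ?T j \<le> p \<longrightarrow> p \<le> length xs \<longrightarrow>
        lev M l \<le> lev M j + row xs bs (?T j) p (length bs) \<longrightarrow> narr m'' aTab l \<le> p)) \<and>
      narr m'' vJ 0 < narr m' vJ 0) ?m ys"
    proof (rule wp_mono[OF scan], elim conjE, goal_cases)
      case (1 m2 ys2)
      have j2: "narr m2 vJ 0 = ?j"
        by (simp add: unchangedD[OF 1(3)])
      have "unchanged {vI, vJ, vPos, vDiag, vTmp, aRow, aTab} m m2"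
        by (rule unchanged_trans[OF um 1(3)]) auto
      moreover have "\<forall>l\<le>height. narr m2 aTab l \<le> ?T l"
        using 1(4) le' order_trans by blast
      moreover have "\<forall>l<?j. narr m2 aTab l = ?T l"
        using 1(5) eq by simp
      moreover have "narr m2 aTab l \<le> p" if "?j \<le> j" "j \<le> l" "l \<le> height" "?T j \<le> p"
          "p \<le> length xs" "lev M l \<le> lev M j + row xs bs (?T j) p (length bs)" for j p l
      proof (cases "j = ?j")
        case True
        then show ?thesis using 1(7) that jh by simp
      next
        case False
        then have "narr m' vJ 0 \<le> j" using that(1) by linarith
        then have "narr m' aTab l \<le> p" using cpl' that by blast
        then show ?thesis using 1(4) that order_trans by blast
      qed
      moreover have "?j \<le> Suc height" "?j < narr m' vJ 0"
        using j by auto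
      ultimately show ?case
        unfolding j2 using 1(2,6) by blast
    qed
    then show ?case
      unfolding ys' using j height_le_length by (intro wp_rules) simp_all
  next
    case (3 m' ys')
    have z: "narr m' vJ 0 = 0"
      using 3 by (auto split: if_splits)
    \<comment> \<open>With \<open>vJ = 0\<close> the accumulated clause covers every level
      \<open>j\<close>.\<close>
    have "complete_table (\<alpha> * (real M / real (M + 1))) xs M height (us @ bs) (narr m' aTab)"
      by (rule complete_table_block[OF cpl snd \<alpha> M_pos lev_height]) (use 3 z in simp)
    moreover have "\<forall>l\<le>height. narr m' aTab l \<le> Suc (length xs)"
      using 3 le order_trans by blast
    ultimately show ?case using 3 by simp
  qed
qed auto

section \<open>Iterating over blocks and producing the output\<close>

lemma wp_rounds_prog:
  assumes base: "base m" and "narr m vRound 0 = 0" "narr m vRead 0 = 0"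
    and T: "\<forall>j\<le>height. narr m aTab j = initial_table j"
  shows "wp rounds_prog (\<lambda>m' ys'. base m' \<and> sound_table xs M height s (narr m' aTab) \<and>
      complete_table ((real M / real (M + 1)) ^ side) xs M height s (narr m' aTab)) m s"
  unfolding rounds_prog_def
proof (rule wp_While[where I = "\<lambda>m' ys'. base m' \<and> narr m' vRound 0 \<le> side \<and>
      narr m' vRead 0 = min (length s) (narr m' vRound 0 * side) \<and> ys' = drop (narr m' vRead 0) s \<and>
      (\<forall>l\<le>height. narr m' aTab l \<le> Suc (length xs)) \<and>
      sound_table xs M height (take (narr m' vRead 0) s) (narr m' aTab) \<and>
      complete_table ((real M / real (M + 1)) ^ narr m' vRound 0) xs M height
        (take (narr m' vRead 0) s) (narr m' aTab)"
      and f = "\<lambda>m'. side - narr m' vRound 0"], goal_cases)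
  case 1
  have "sound_table xs M height [] (narr m aTab)"
    using T by (simp add: sound_table_def initial_table_def reach_0)
  \<comment> \<open>On the empty stream only length 0 is reachable, witnessed by level 0 with the
    empty prefix.\<close>
  moreover have "complete_table 1 xs M height [] (narr m aTab)"
    using T by (auto simp: complete_table_def initial_table_def reach_def intro!: exI[of _ 0])
  ultimately show ?case
    using assms by (simp add: initial_table_def)
next
  case (2 m' ys')
  define t where "t = narr m' vRound 0"
  define r where "r = narr m' vRead 0"
  define bs where "bs = take side (drop r s)"
  let ?q = "real M / real (M + 1)"
  have base': "base m'" and r: "r = min (length s) (t * side)" "r \<le> length s" and ys': "ys' = drop r s"
    and le: "\<forall>l\<le>height. narr m' aTab l \<le> Suc (length xs)"
    and snd: "sound_table xs M height (take r s) (narr m' aTab)"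
    and cpl: "complete_table (?q ^ t) xs M height (take r s) (narr m' aTab)"
    using 2 unfolding t_def r_def by auto
  have t: "t < side"
    using 2 by (auto simp: t_def base_def split: if_splits)
  let ?r = "min (length s) (r + side)"
  have r': "?r = min (length s) (Suc t * side)"
    using r by auto
  have app: "take r s @ bs = take ?r s"
    unfolding bs_def by (metis min.commute take_add take_all_iff min_def nle_le)
  have q: "?q ^ t \<le> 1"
    by (intro power_le_one) auto
  show ?case
  proof (rule wp_Seq, rule wp_mono[OF wp_read_prog[OF base' r_def[symmetric] r(2) ys']],
      elim conjE, goal_cases)
    case (1 m1 ys1)
    note u1 = unchangedD[OF 1(2)]
    have base1: "base m1"
      using base_unchanged[OF base' 1(2)] by simp
    have tab1: "\<forall>l\<le>height. narr m1 aTab l \<le> Suc (length xs)"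
        "sound_table xs M height (take r s) (narr m1 aTab)"
        "complete_table (?q ^ t) xs M height (take r s) (narr m1 aTab)"
      using le snd cpl by (simp_all add: u1)
    show ?case
    proof (rule wp_Seq, rule wp_mono[OF wp_block_prog[OF base1 1(3)[folded bs_def] tab1 q]], elim conjE, goal_cases)
      case (1 m2 ys2)
      note u2 = unchangedD[OF 1(3)]
      have base2: "base m2"
        using base_unchanged[OF base1 1(3)] by simp
      have t2: "narr m2 vRound 0 = t" "narr m2 vRead 0 = ?r"
        using \<open>narr m1 vRead 0 = ?r\<close> by (simp_all add: u1 u2 t_def)
      let ?m = "upd m2 vRound 0 (Num (Suc t))"
      have "base ?m"
        using base2 by (simp add: base_def)
      moreover have "narr ?m aTab = narr m2 aTab"
        by simp
      moreover have "?q ^ Suc t = ?q ^ t * ?q"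
        by simp
      ultimately show ?case
        using 1 t t2 r' side_le \<open>ys1 = drop ?r s\<close> unfolding inc_def app t_def[symmetric]
        by (intro wp_rules) (simp_all del: power_Suc)
    qed
  qed
next
  case (3 m' ys')
  then have t: "narr m' vRound 0 = side"
    by (auto simp: base_def split: if_splits)
  \<comment> \<open>Since \<open>side * side >= n\<close>, the rounds exhaust the stream.\<close>
  then have "narr m' vRead 0 = length s"
    using 3 side_square by (simp add: length_s)
  then show ?case using 3 t by auto
qed

text \<open>Each valid level overwrites the one before, so the last write is the largest.
  Quantifying over all \<open>i\<close> says this without naming the maximum.\<close>

lemma wp_output_prog:
  assumes base: "base m"
  shows "wp output_prog (\<lambda>m' ys'. \<forall>i\<le>height. narr m aTab i \<le> length xs \<longrightarrow>
      (\<exists>j\<ge>i. j \<le> height \<and> narr m aTab j \<le> length xs \<and> arr m' vOut 0 = Num (lev M j))) m ys"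
  unfolding output_prog_def
proof (intro wp_rules, goal_cases)
  case 4
  show ?case
  proof (rule wp_While[where I = "\<lambda>m' ys'. unchanged {vOut, vJ} m m' \<and> narr m' vJ 0 \<le> Suc height \<and>
      (\<forall>i<narr m' vJ 0. narr m aTab i \<le> length xs \<longrightarrow>
        (\<exists>j\<ge>i. j \<le> height \<and> narr m aTab j \<le> length xs \<and> arr m' vOut 0 = Num (lev M j)))"
      and f = "\<lambda>m'. Suc height - narr m' vJ 0"], goal_cases)
    case (2 m' ys')
    let ?c = "narr m' vJ 0"
    have u: "unchanged {vOut, vJ} m m'"
      using 2 by simp
    have top: "narr m' vTop 0 = height" "narr m' aTab ?c = narr m aTab ?c"
      using base by (auto simp: unchangedD[OF u] base_def)
    have c: "?c \<le> height"
      using 2 top by (auto split: if_splits)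
    have lv: "narr m' aLev ?c = lev M ?c"
      using base c by (auto simp: unchangedD[OF u] base_def)
    have V: "lev M ?c \<le> 2 * length xs + 2"
      using fits_narr[of m' aLev ?c] 2 lv by simp
    show ?case
    proof (intro wp_Seq wp_Cond, goal_cases)
      case 1
      then have "narr m aTab ?c \<le> length xs"
        using top by (auto split: if_splits)
      then show ?case
        using 2 c lv V height_le_length unfolding inc_def
        by (intro wp_rules) (auto simp: less_Suc_eq intro!: exI[of _ ?c])
    next
      case n: 2
      then have "\<not> narr m aTab ?c \<le> length xs"
        using top by (auto split: if_splits)
      then show ?case
        using 2 c height_le_length unfolding inc_def
        by (intro wp_rules wp_Skip) (auto simp: less_Suc_eq)
    qed
  next
    case (3 m' ys')
    have "narr m' vTop 0 = height"
      using 3 base by (auto simp: unchangedD base_def)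
    then have "narr m' vJ 0 = Suc height"
      using 3 by (auto split: if_splits)
    then show ?case using 3 by (simp add: less_Suc_eq_le)
  qed simp
qed auto

lemma wp_lcs_prog:
  assumes "k > 1"
  shows "wp lcs_prog (\<lambda>m' ys'. \<exists>L. arr m' vOut 0 = Num L \<and> L \<le> lcs xs s \<and>
      (real M / real (M + 1)) ^ side * real (lcs xs s) \<le> real L) [] s"
  unfolding lcs_prog_def
proof (rule wp_Cond, rule wp_Seq, rule wp_mono, rule wp_side_prog, simp, elim conjE, goal_cases)
  case (1 m1 ys1)
  note u1 = unchangedD[OF 1(4)]
  have z1: "narr m1 vTop 0 = 0" "narr m1 aLev 0 = 0" "narr m1 aTab 0 = 0"
    by (simp_all add: u1)
  show ?case
  proof (rule wp_Seq, rule wp_mono[OF wp_levels_prog[OF 1(5) z1]], elim conjE, goal_cases)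
    case (1 m2 ys2)
    note u2 = unchangedD[OF 1(3)]
    have z2: "narr m2 vRound 0 = 0" "narr m2 vRead 0 = 0"
      by (simp_all add: u1 u2)
    have "ys2 = s"
      using 1(2) \<open>ys1 = s\<close> by simp
    show ?case
      unfolding \<open>ys2 = s\<close>
    proof (rule wp_Seq, rule wp_mono[OF wp_rounds_prog[OF 1(4) z2 1(5)]], elim conjE, goal_cases)
      case (1 m3 ys3)
      let ?\<alpha> = "(real M / real (M + 1)) ^ side"
      \<comment> \<open>Completeness is applied to the whole offline string and the optimal
        length.\<close>
      have "reach xs s (length xs) (lcs xs s)"
        by (simp add: reach_iff_le_lcs)
      then obtain i where i: "i \<le> height" "narr m3 aTab i \<le> length xs"
          "?\<alpha> * real (lcs xs s) \<le> real (lev M i)"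
        using 1 by (fastforce simp: complete_table_def)
      show ?case
      proof (rule wp_mono[OF wp_output_prog[OF 1(2)]], goal_cases)
        case (1 m4 ys4)
        then obtain j where j: "i \<le> j" "j \<le> height" "narr m3 aTab j \<le> length xs"
            "arr m4 vOut 0 = Num (lev M j)"
          using i by auto
        have "reach xs s (narr m3 aTab j) (lev M j)"
          using \<open>sound_table xs M height s (narr m3 aTab)\<close> j by (simp add: sound_table_def)
        from reach_mono[OF this j(3), of "[]"] have "lev M j \<le> lcs xs s"
          by (simp add: reach_iff_le_lcs)
        moreover have "lev M i \<le> lev M j"
          using j by (simp add: strict_mono_less_eq[OF strict_mono_lev])
        then have "?\<alpha> * real (lcs xs s) \<le> real (lev M j)"
          using i(3) by linarith
        ultimately show ?case using j by simp
      qed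
    qed
  qed
next
  case 2
  then show ?case using assms length_pos by simp
qed

lemma stream_output_lcs_prog:
  assumes "k > 1"
  obtains L where "stream_output lcs_prog k xs s budget L" "L \<le> lcs xs s"
    "(1 - 1 / real k) * real (lcs xs s) \<le> real L"
proof -
  have "fits []"
    unfolding fits_def by simp
  then obtain m ys L where L: "exec xs k budget lcs_prog ([], s) (m, ys)" "arr m vOut 0 = Num L"
      "L \<le> lcs xs s" "(real M / real (M + 1)) ^ side * real (lcs xs s) \<le> real L"
    using wp_lcs_prog[OF assms] unfolding wp_def by blast
  \<comment> \<open>With \<open>M = k * side\<close>, the \<open>side\<close> rounds lose at most
    \<open>side / (M + 1) <= 1 / k\<close> in total.\<close>
  have "1 - 1 / real k = 1 - real side / real M"
    using side_pos by (simp add: M_def)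
  also have "\<dots> \<le> 1 + real side * (- 1 / real (M + 1))"
    using M_pos by (simp add: field_simps)
  also have "\<dots> \<le> (1 + (- 1 / real (M + 1))) ^ side"
    by (rule Bernoulli_inequality) (use M_pos in \<open>simp add: field_simps\<close>)
  also have "1 + (- 1 / real (M + 1)) = real M / real (M + 1)"
    by (simp add: field_simps)
  finally have "(1 - 1 / real k) * real (lcs xs s) \<le> (real M / real (M + 1)) ^ side * real (lcs xs s)"
    by (intro mult_right_mono) auto
  with L(4) have "(1 - 1 / real k) * real (lcs xs s) \<le> real L"
    by linarith
  moreover have "stream_output lcs_prog k xs s budget L"
    using L(1,2) by (auto simp: stream_output_def arr_def)
  ultimately show ?thesis using that L(3) by blast
qed

section \<open>Memory bound\<close>

lemma side_le_sqrt: "real side \<le> 2 * sqrt (real (length xs))"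
proof -
  have "(side - 1) * (side - 1) < length xs"
    using below_side side_pos by simp
  then have "real (side - 1) * real (side - 1) \<le> real (length xs)"
    by (metis less_imp_le of_nat_le_iff of_nat_mult)
  then have "real (side - 1) \<le> sqrt (real (length xs))"
    by (intro real_le_rsqrt) (simp add: power2_eq_square)
  \<comment> \<open>This absorbs the 1 lost in passing from \<open>side\<close> to
    \<open>side - 1\<close>.\<close>
  moreover have "1 \<le> sqrt (real (length xs))"
    using length_pos by (simp add: Suc_leI del: length_greater_0_conv)
  ultimately show ?thesis using side_pos by linarith
qed

lemma height_bound: "height \<le> 1 + M * (floor_log (length xs) + 1)"
proof (rule height_le)
  have "length xs \<le> 2 ^ (floor_log (length xs) + 1)"
    using floor_log_exp2_gt[of "length xs"] by simp
  also have "\<dots> \<le> lev M (1 + M * (floor_log (length xs) + 1))"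
    by (rule lev_ge_power[OF M_pos])
  finally show "length xs \<le> lev M (1 + M * (floor_log (length xs) + 1))" .
qed

text \<open>One logarithm comes from the number of levels, the other from the bit length of a
  cell.\<close>

lemma budget_bound:
  "real budget \<le> 1000 * real k * sqrt (real (length xs)) * log 2 (real (length xs) + 2) ^ 2"
proof -
  define n where "n = real (length xs)"
  define \<Lambda> where "\<Lambda> = log 2 (n + 2)"
  have n: "n \<ge> 1"
    using length_pos by (simp add: n_def Suc_leI)
  have \<Lambda>: "\<Lambda> \<ge> 1"
    unfolding \<Lambda>_def using n by simp
  have fl: "real (floor_log m) \<le> log 2 (real m)" if "m > 0" for m
    using that of_nat_floor[of "log 2 (real m)"] by (simp add: floor_log_altdef)
  have mono: "log 2 x \<le> log 2 y" if "0 < x" "x \<le> y" for x y :: real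
    using that by simp
  have "real (floor_log (length xs)) \<le> \<Lambda>"
    using fl[OF length_pos] n mono[of n "n + 2"] unfolding \<Lambda>_def n_def by linarith
  then have a: "real (floor_log (length xs)) + 1 \<le> 2 * \<Lambda>"
    using \<Lambda> by linarith
  have "real (floor_log (2 * length xs + 2)) \<le> log 2 (real (2 * length xs + 2))"
    by (rule fl) simp
  also have "\<dots> \<le> log 2 (2 * (n + 2))"
    by (rule mono) (simp_all add: n_def)
  also have "\<dots> = 1 + \<Lambda>"
    by (subst log_mult_pos) (use n in \<open>simp_all add: \<Lambda>_def\<close>)
  finally have b: "real (floor_log (2 * length xs + 2)) + 1 \<le> 3 * \<Lambda>"
    using \<Lambda> by linarith
  define K where "K = real k * real side"
  have "1 \<le> real k" "1 \<le> real side"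
    using k_pos side_pos by simp_all
  then have K: "real side \<le> K" "1 \<le> K"
    using mult_mono[of 1 "real k" "real side" "real side"] unfolding K_def by linarith+
  have "real height \<le> real (1 + M * (floor_log (length xs) + 1))"
    using height_bound by (simp only: of_nat_le_iff)
  also have "\<dots> = 1 + K * (real (floor_log (length xs)) + 1)"
    by (simp add: M_def K_def algebra_simps)
  also have "\<dots> \<le> 1 + K * (2 * \<Lambda>)"
    using a K by (intro add_left_mono mult_left_mono) auto
  finally have h: "real height \<le> 1 + 2 * (K * \<Lambda>)"
    by simp
  have KL: "K \<le> K * \<Lambda>"
    using K \<Lambda> by simp
  \<comment> \<open>The sum is at most \<open>3 + 3 * (K * \<Lambda>)\<close>, and
    \<open>K * \<Lambda> >= 1\<close>.\<close>
  have w: "real (height + side + 2) \<le> 6 * (K * \<Lambda>)"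
    using h K KL by linarith
  have "real budget = 16 * real (height + side + 2) * (real (floor_log (2 * length xs + 2)) + 1)"
    unfolding budget_def by (simp only: of_nat_mult of_nat_add of_nat_numeral of_nat_1)
  also have "\<dots> \<le> 16 * (6 * (K * \<Lambda>)) * (3 * \<Lambda>)"
    using w b K \<Lambda> by (intro mult_mono) auto
  also have "\<dots> = 288 * \<Lambda> ^ 2 * K"
    by (simp add: power2_eq_square)
  also have "\<dots> \<le> 288 * \<Lambda> ^ 2 * (real k * (2 * sqrt n))"
    unfolding K_def n_def by (intro mult_left_mono side_le_sqrt) auto
  \<comment> \<open>The constant is \<open>288 * 2 = 576\<close>, rounded up.\<close>
  also have "\<dots> \<le> 1000 * real k * sqrt n * \<Lambda> ^ 2"
    using n by simp
  finally show ?thesis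
    by (simp add: n_def \<Lambda>_def)
qed

end

section \<open>Choice of the precision and degenerate cases\<close>

theorem theorem5:
  "\<exists>(P :: cmd) (C :: real) (d :: nat).
     \<forall>(\<epsilon> :: real) (n :: nat) (sbar :: 'a list) (s :: 'a list).
       \<epsilon> > 0 \<and> length sbar = n \<and> length s = n \<longrightarrow>
       (\<exists>B L. stream_output P (nat \<lceil>1 / \<epsilon>\<rceil>) sbar s B L
          \<and> (1 - \<epsilon>) * real (lcs sbar s) \<le> real L
          \<and> L \<le> lcs sbar s
          \<and> real B \<le> C * (sqrt (real n) / \<epsilon>) * log 2 (real n + 2) ^ d)"
proof (rule exI[of _ lcs_prog], rule exI[of _ 2000], rule exI[of _ 2], intro allI impI, elim conjE)
  fix \<epsilon> :: real and n :: nat and sbar s :: "'a list"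
  assume \<epsilon>: "\<epsilon> > 0" and len: "length sbar = n" "length s = n"
  define k where "k = nat \<lceil>1 / \<epsilon>\<rceil>"
  have k: "1 / \<epsilon> \<le> real k" "real k \<le> 1 / \<epsilon> + 1"
    using \<epsilon> ceiling_correct[of "1 / \<epsilon>"] by (simp_all add: k_def)
  show "\<exists>B L. stream_output lcs_prog (nat \<lceil>1 / \<epsilon>\<rceil>) sbar s B L
          \<and> (1 - \<epsilon>) * real (lcs sbar s) \<le> real L
          \<and> L \<le> lcs sbar s
          \<and> real B \<le> 2000 * (sqrt (real n) / \<epsilon>) * log 2 (real n + 2) ^ 2"
  proof (cases "n > 0 \<and> k > 1")
    case True
    then interpret lcs_run sbar s k
      using len by unfold_locales auto
    obtain L where L: "stream_output lcs_prog k sbar s budget L" "L \<le> lcs sbar s"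
        "(1 - 1 / real k) * real (lcs sbar s) \<le> real L"
      using stream_output_lcs_prog True by blast
    have "1 / real k \<le> \<epsilon>"
      using k(1) \<epsilon> True by (simp add: field_simps)
    then have "(1 - \<epsilon>) * real (lcs sbar s) \<le> (1 - 1 / real k) * real (lcs sbar s)"
      by (intro mult_right_mono) auto
    then have "(1 - \<epsilon>) * real (lcs sbar s) \<le> real L"
      using L(3) by linarith
    \<comment> \<open>From \<open>k >= 2\<close> follows
      \<open>k / 2 <= k - 1 <= 1 / \<epsilon>\<close>. This factor 2 turns 1000 into 2000.\<close>
    moreover have "real k \<le> 2 / \<epsilon>"
      using k(2) True by (simp add: field_simps)
    then have "1000 * real k * (sqrt (real n) * log 2 (real n + 2) ^ 2)
        \<le> 1000 * (2 / \<epsilon>) * (sqrt (real n) * log 2 (real n + 2) ^ 2)"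
      by (intro mult_right_mono mult_left_mono) auto
    then have "real budget \<le> 2000 * (sqrt (real n) / \<epsilon>) * log 2 (real n + 2) ^ 2"
      using budget_bound unfolding len by (simp add: mult_ac)
    ultimately show ?thesis using L unfolding k_def by blast
  next
    case False
    \<comment> \<open>No write happens, so the bound 0 holds, and cell 0 of the empty memory reads
      as 0.\<close>
    have "exec sbar k 0 lcs_prog ([], s) ([], s)"
      unfolding lcs_prog_def using False len by (intro exec.CondFalse exec.Skip) auto
    then have "stream_output lcs_prog k sbar s 0 0"
      by (auto simp: stream_output_def cell_def)
    moreover have "(1 - \<epsilon>) * real (lcs sbar s) \<le> 0"
    proof (cases "n = 0")
      case True
      then have "lcs sbar s = 0"
        using len reach_iff_le_lcs[of sbar s "length sbar"] reach_le_length[of sbar s "length sbar"]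
        by auto
      then show ?thesis by simp
    next
      case n: False
      then have "1 / \<epsilon> \<le> 1"
        using False k(1) by linarith
      then have "1 - \<epsilon> \<le> 0"
        using \<epsilon> by (simp add: field_simps)
      then show ?thesis
        by (simp add: mult_nonpos_nonneg)
    qed
    ultimately show ?thesis
      using \<epsilon> unfolding k_def by (intro exI[of _ 0]) auto
  qed
qed

end
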